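(* For each sentence $\phi$ of safety LTL$^\downarrow_1(\mathtt{X},\mathtt{R})$ over a finite alphabet $\Sigma$, a safety 1ARA$_1$ $\mathcal{A}_\phi$ with alphabet $\Sigma$ and $\mathrm{L}(\phi)=\mathrm{L}(\mathcal{A}_\phi)$ is computable from $\phi$ in logarithmic space.
   Context: A data $\omega$-word $\sigma$ over a finite alphabet $\Sigma$ consists of an $\omega$-word $\sigma(0)\sigma(1)\cdots$ over $\Sigma$ together with an equivalence relation $\sim$ on $\mathbb{N}$; $[i]_\sim$ denotes the class of $i$. Safety LTL$^\downarrow_1(\mathtt{X},\mathtt{R})$ formulae over $\Sigma$ are given by $\phi::= a\mid\top\mid\bot\mid\phi\wedge\phi\mid\phi\vee\phi\mid\mathtt{X}\phi\mid\phi\mathtt{R}\phi\mid{\downarrow}\phi\mid{\uparrow}\mid{\not\uparrow}$ with $a\in\Sigma$; ${\downarrow}\phi$ binds the free occurrences of $\uparrow,\not\uparrow$ in $\phi$, and a sentence has no free such occurrences. For a position $i$ and a class $D$ of $\sim$: $\sigma,i\models_D a$ iff $\sigma(i)=a$; Boolean cases as usual; $\sigma,i\models_D\mathtt{X}\phi$ iff $\sigma,i+1\models_D\phi$; $\sigma,i\models_D\phi\mathtt{R}\psi$ iff either $\sigma,k\models_D\psi$ for all $k\ge i$, or there is $j\ge i$ with $\sigma,j\models_D\phi$ and $\sigma,k\models_D\psi$ for all $k\in\{i,\dots,j\}$; $\sigma,i\models_D{\downarrow}\phi$ iff $\sigma,i\models_{[i]_\sim}\phi$; $\sigma,i\models_D{\uparrow}$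 iff $i\in D$; $\sigma,i\models_D{\not\uparrow}$ iff $i\notin D$. For a sentence $\phi$, $\mathrm{L}(\phi)$ is the set of data $\omega$-words $\sigma$ over $\Sigma$ with $\sigma,0\models\phi$. For a finite set $Q$, let $\mathcal{B}^+_\downarrow(Q)$ be the set of positive Boolean formulae built from atoms $q$, $\downarrow q$ ($q\in Q$), $\top$, $\bot$ with $\wedge,\vee$; a pair $Q',Q'_\downarrow\subseteq Q$ satisfies $q$ iff $q\in Q'$, satisfies $\downarrow q$ iff $q\in Q'_\downarrow$, always $\top$, never $\bot$, with $\wedge,\vee$ as usual. A safety 1ARA$_1$ is $\mathcal{A}=\langle\Sigma,Q,q_I,\delta\rangle$ with $Q$ finite, $q_I\in Q$, $\delta:(Q\times\Sigma\times\{\uparrow,\not\uparrow\})\to\mathcal{B}^+_\downarrow(Q)$. Configurations are pairs $\langle q,D\rangle$ ($q\in Q$, $D$ a class of $\sim$). For finite sets $F,F'$ of configurations, $F\xrightarrow{\sigma,i}F'$ iff for each $\langle q,D\rangle\in F$ there are $Q^{\langle q,D\rangle},Q^{\langle q,D\rangle}_\downarrow\subseteq Q$ satisfying $\delta(q,\sigma(i),\uparrow)$ if $D=[i]_\sim$, or $\delta(q,\sigma(i),\not\uparrow)$ otherwise, with $F'=\{\langle q',D\rangle:\langle q,D\rangle\in F,q'\in Q^{\langle q,D\rangle}\}\cup\{\langle q',[i]_\sim\rangle:\langle q,D\rangle\in F,q'\in Q^{\langle q,D\rangle}_\downarrow\}$. $\mathrm{L}(\mathcal{A})$ is the set of data $\omega$-words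 $\sigma$ over $\Sigma$ for which there is an infinite sequence $F_0\xrightarrow{\sigma,0}F_1\xrightarrow{\sigma,1}\cdots$ with $F_0=\{\langle q_I,[0]_\sim\rangle\}$. *)

theory Defs
  imports Complex_Main "HOL-Library.Landau_Symbols"
begin

section \<open>Data words\<close>

record 'a data_word =
  letter :: "nat \<Rightarrow> 'a"
  eqr :: "(nat \<times> nat) set"

definition data_words :: "'a set \<Rightarrow> 'a data_word set" where
  "data_words \<Sigma> = {\<sigma>. range (letter \<sigma>) \<subseteq> \<Sigma> \<and> equiv UNIV (eqr \<sigma>)}"

definition classes :: "'a data_word \<Rightarrow> nat set set" where
  "classes \<sigma> = UNIV // eqr \<sigma>"

definition cls :: "'a data_word \<Rightarrow> nat \<Rightarrow> nat set" where
  "cls \<sigma> i = eqr \<sigma> `` {i}"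


section \<open>Safety LTL with one register\<close>

datatype (letters: 'a) ltl =
    Letter 'a
  | Top
  | Bot
  | And "'a ltl" "'a ltl"
  | Or "'a ltl" "'a ltl"
  | Next "'a ltl"
  | Release "'a ltl" "'a ltl"
  | Freeze "'a ltl"
  | Up
  | NotUp

text \<open>Since there is only one register, \<^term>\<open>Freeze \<phi>\<close> has no free occurrence of
  \<^term>\<open>Up\<close> or \<^term>\<open>NotUp\<close>.\<close>

primrec sentence :: "'a ltl \<Rightarrow> bool" where
  "sentence (Letter a) = True"
| "sentence Top = True"
| "sentence Bot = True"
| "sentence (And \<phi> \<psi>) = (sentence \<phi> \<and> sentence \<psi>)"
| "sentence (Or \<phi> \<psi>) = (sentence \<phi> \<and> sentence \<psi>)"
| "sentence (Next \<phi>) = sentence \<phi>"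
| "sentence (Release \<phi> \<psi>) = (sentence \<phi> \<and> sentence \<psi>)"
| "sentence (Freeze \<phi>) = True"
| "sentence Up = False"
| "sentence NotUp = False"

primrec sat :: "'a data_word \<Rightarrow> nat \<Rightarrow> nat set \<Rightarrow> 'a ltl \<Rightarrow> bool" where
  "sat \<sigma> i D (Letter a) \<longleftrightarrow> letter \<sigma> i = a"
| "sat \<sigma> i D Top \<longleftrightarrow> True"
| "sat \<sigma> i D Bot \<longleftrightarrow> False"
| "sat \<sigma> i D (And \<phi> \<psi>) \<longleftrightarrow> sat \<sigma> i D \<phi> \<and> sat \<sigma> i D \<psi>"
| "sat \<sigma> i D (Or \<phi> \<psi>) \<longleftrightarrow> sat \<sigma> i D \<phi> \<or> sat \<sigma> i D \<psi>"
| "sat \<sigma> i D (Next \<phi>) \<longleftrightarrow> sat \<sigma> (i + 1) D \<phi>"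
| "sat \<sigma> i D (Release \<phi> \<psi>) \<longleftrightarrow>
     (\<forall>k\<ge>i. sat \<sigma> k D \<psi>) \<or> (\<exists>j\<ge>i. sat \<sigma> j D \<phi> \<and> (\<forall>k\<in>{i..j}. sat \<sigma> k D \<psi>))"
| "sat \<sigma> i D (Freeze \<phi>) \<longleftrightarrow> sat \<sigma> i (cls \<sigma> i) \<phi>"
| "sat \<sigma> i D Up \<longleftrightarrow> i \<in> D"
| "sat \<sigma> i D NotUp \<longleftrightarrow> i \<notin> D"

lemma sat_sentence_indep: "sentence \<phi> \<Longrightarrow> sat \<sigma> i D \<phi> \<longleftrightarrow> sat \<sigma> i D' \<phi>"
proof (induction \<phi> arbitrary: i)
  case (And \<phi> \<psi>)
  then show ?case by (metis sat.simps(4) sentence.simps(4))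
next
  case (Or \<phi> \<psi>)
  then show ?case by (metis sat.simps(5) sentence.simps(5))
next
  case (Release \<phi> \<psi>)
  then have "sat \<sigma> k D \<phi> = sat \<sigma> k D' \<phi>" "sat \<sigma> k D \<psi> = sat \<sigma> k D' \<psi>" for k
    by simp_all
  then show ?case by simp
qed simp_all

text \<open>By the preceding lemma, the class chosen below is immaterial when \<open>\<phi>\<close> is a sentence.\<close>

definition lang_ltl :: "'a set \<Rightarrow> 'a ltl \<Rightarrow> 'a data_word set" where
  "lang_ltl \<Sigma> \<phi> = {\<sigma> \<in> data_words \<Sigma>. sat \<sigma> 0 (cls \<sigma> 0) \<phi>}"


section \<open>Safety one-way alternating automata with one register\<close>

datatype (atoms: 'q) pbf =
    Atom 'q
  | FreezeAtom 'q
  | PTop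
  | PBot
  | PAnd "'q pbf" "'q pbf"
  | POr "'q pbf" "'q pbf"

primrec sat_pbf :: "'q set \<Rightarrow> 'q set \<Rightarrow> 'q pbf \<Rightarrow> bool" where
  "sat_pbf P P\<^sub>d (Atom q) \<longleftrightarrow> q \<in> P"
| "sat_pbf P P\<^sub>d (FreezeAtom q) \<longleftrightarrow> q \<in> P\<^sub>d"
| "sat_pbf P P\<^sub>d PTop \<longleftrightarrow> True"
| "sat_pbf P P\<^sub>d PBot \<longleftrightarrow> False"
| "sat_pbf P P\<^sub>d (PAnd f g) \<longleftrightarrow> sat_pbf P P\<^sub>d f \<and> sat_pbf P P\<^sub>d g"
| "sat_pbf P P\<^sub>d (POr f g) \<longleftrightarrow> sat_pbf P P\<^sub>d f \<or> sat_pbf P P\<^sub>d g"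

text \<open>The Boolean argument of the transition function is \<^const>\<open>True\<close> for \<open>\<up>\<close> (the register holds
  the class of the current position) and \<^const>\<open>False\<close> for its negation.\<close>

record ('q, 'a) ara =
  states :: "'q set"
  start :: 'q
  delta :: "'q \<Rightarrow> 'a \<Rightarrow> bool \<Rightarrow> 'q pbf"

definition safety_ara :: "'a set \<Rightarrow> ('q, 'a) ara \<Rightarrow> bool" where
  "safety_ara \<Sigma> A \<longleftrightarrow> finite (states A) \<and> start A \<in> states A \<and>
     (\<forall>q\<in>states A. \<forall>a\<in>\<Sigma>. \<forall>b. atoms (delta A q a b) \<subseteq> states A)"

definition ara_step ::
  "('q, 'a) ara \<Rightarrow> 'a data_word \<Rightarrow> nat \<Rightarrow> ('q \<times> nat set) set \<Rightarrow> ('q \<times> nat set) set \<Rightarrow> bool" where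
  "ara_step A \<sigma> i F F' \<longleftrightarrow>
     finite F \<and> finite F' \<and>
     F \<subseteq> states A \<times> classes \<sigma> \<and> F' \<subseteq> states A \<times> classes \<sigma> \<and>
     (\<exists>P P\<^sub>d.
        (\<forall>(q, D)\<in>F. P (q, D) \<subseteq> states A \<and> P\<^sub>d (q, D) \<subseteq> states A \<and>
           sat_pbf (P (q, D)) (P\<^sub>d (q, D)) (delta A q (letter \<sigma> i) (D = cls \<sigma> i))) \<and>
        F' = {(q', D) | q' q D. (q, D) \<in> F \<and> q' \<in> P (q, D)} \<union>
             {(q', cls \<sigma> i) | q' q D. (q, D) \<in> F \<and> q' \<in> P\<^sub>d (q, D)})"

definition lang_ara :: "'a set \<Rightarrow> ('q, 'a) ara \<Rightarrow> 'a data_word set" where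
  "lang_ara \<Sigma> A = {\<sigma> \<in> data_words \<Sigma>.
     \<exists>F. F 0 = {(start A, cls \<sigma> 0)} \<and> (\<forall>i. ara_step A \<sigma> i (F i) (F (Suc i)))}"


section \<open>Functions computable in logarithmic space\<close>

text \<open>
  Deterministic Turing transducers with a two-way read-only input tape delimited by end markers,
  finitely many read-write work tapes that are infinite to the right, and a write-only output
  tape. A head does not move when asked to leave its tape. Control states and work symbols are
  drawn from finite sets of natural numbers, with the symbol 0 as the blank. A transition maps the
  state, the scanned input cell and the list of scanned work symbols to the new state, the
  direction of the input head, the written symbol and direction for each work tape, and the symbol
  (if any) that is appended to the output; \<^const>\<open>None\<close> means that the machine halts.
\<close>

datatype dir = GoLeft | Stay | GoRight

datatype 'i icell = LeftEnd | Sym 'i | RightEnd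

record ('i, 'o) transducer =
  num_tapes :: nat
  control :: "nat set"
  work_syms :: "nat set"
  start_state :: nat
  trans :: "nat \<Rightarrow> 'i icell \<Rightarrow> nat list \<Rightarrow> (nat \<times> dir \<times> (nat \<times> dir) list \<times> 'o option) option"

definition transducer_wf :: "('i, 'o) transducer \<Rightarrow> bool" where
  "transducer_wf M \<longleftrightarrow>
     finite (control M) \<and> finite (work_syms M) \<and> start_state M \<in> control M \<and> 0 \<in> work_syms M \<and>
     (\<forall>q\<in>control M. \<forall>c ss q' d ws out.
        length ss = num_tapes M \<and> set ss \<subseteq> work_syms M \<and> trans M q c ss = Some (q', d, ws, out) \<longrightarrow>
        q' \<in> control M \<and> length ws = num_tapes M \<and> fst ` set ws \<subseteq> work_syms M)"

text \<open>Work tapes and their cells are numbered from 0. The input head ranges over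
  \<open>0, \<dots>, length w + 1\<close>, the outermost positions being those of the end markers.\<close>

record 'o config =
  cstate :: nat
  ipos :: nat
  tape :: "nat \<Rightarrow> nat \<Rightarrow> nat"
  wpos :: "nat \<Rightarrow> nat"
  outp :: "'o list"

definition init_config :: "('i, 'o) transducer \<Rightarrow> 'o config" where
  "init_config M = \<lparr>cstate = start_state M, ipos = 0, tape = (\<lambda>_ _. 0), wpos = (\<lambda>_. 0), outp = []\<rparr>"

definition icell_at :: "'i list \<Rightarrow> nat \<Rightarrow> 'i icell" where
  "icell_at w p = (if p = 0 then LeftEnd else if p \<le> length w then Sym (w ! (p - 1)) else RightEnd)"

fun move :: "dir \<Rightarrow> nat \<Rightarrow> nat" where
  "move GoLeft p = p - 1"
| "move Stay p = p"
| "move GoRight p = Suc p"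

definition step :: "('i, 'o) transducer \<Rightarrow> 'i list \<Rightarrow> 'o config \<Rightarrow> 'o config option" where
  "step M w c =
     (case trans M (cstate c) (icell_at w (ipos c))
             (map (\<lambda>j. tape c j (wpos c j)) [0..<num_tapes M]) of
        None \<Rightarrow> None
      | Some (q, d, ws, out) \<Rightarrow> Some
          \<lparr>cstate = q,
           ipos = min (move d (ipos c)) (length w + 1),
           tape = (\<lambda>j. if j < num_tapes M then (tape c j)(wpos c j := fst (ws ! j)) else tape c j),
           wpos = (\<lambda>j. if j < num_tapes M then move (snd (ws ! j)) (wpos c j) else wpos c j),
           outp = outp c @ (case out of None \<Rightarrow> [] | Some x \<Rightarrow> [x])\<rparr>)"

definition reachable :: "('i, 'o) transducer \<Rightarrow> 'i list \<Rightarrow> 'o config \<Rightarrow> bool" where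
  "reachable M w c \<longleftrightarrow> (\<lambda>c c'. step M w c = Some c')\<^sup>*\<^sup>* (init_config M) c"

definition outputs :: "('i, 'o) transducer \<Rightarrow> 'i list \<Rightarrow> 'o list \<Rightarrow> bool" where
  "outputs M w v \<longleftrightarrow> (\<exists>c. reachable M w c \<and> step M w c = None \<and> outp c = v)"

text \<open>At most the first \<open>s (length w)\<close> cells of each work tape are ever scanned on input \<open>w\<close>.\<close>

definition space_bounded :: "('i, 'o) transducer \<Rightarrow> (nat \<Rightarrow> nat) \<Rightarrow> bool" where
  "space_bounded M s \<longleftrightarrow>
     (\<forall>w c. reachable M w c \<longrightarrow> (\<forall>j<num_tapes M. wpos c j < s (length w)))"

definition logspace_computable :: "('i::finite list \<Rightarrow> 'o::finite list) \<Rightarrow> bool" where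
  "logspace_computable f \<longleftrightarrow>
     (\<exists>(M :: ('i, 'o) transducer) s.
        transducer_wf M \<and> space_bounded M s \<and>
        (\<lambda>n. real (s n)) \<in> O(\<lambda>n. ln (real n)) \<and>
        (\<forall>w. outputs M w (f w)))"


section \<open>Encodings of sentences and automata as words\<close>

text \<open>
  An alphabet (or state set) is presented by a duplicate-free enumeration of its elements, and
  each element is represented by its index in unary. As both the alphabet and the state set are
  themselves written out (in unary, as their number of elements), binary indices would change the
  length of an encoding only polynomially. Formulae are in prefix notation, so that no parentheses
  are needed.
\<close>

definition idx :: "'a list \<Rightarrow> 'a \<Rightarrow> nat" where
  "idx xs x = length (takeWhile (\<lambda>y. y \<noteq> x) xs)"

datatype isym = ITick | ISep | ILetter | ITop | IBot | IAnd | IOr | INext | IRelease | IFreeze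
  | IUp | INotUp

datatype osym = OTick | OSep | OAtom | OFreezeAtom | OTop | OBot | OAnd | OOr

instance isym :: finite
proof
  have "(UNIV :: isym set) = {ITick, ISep, ILetter, ITop, IBot, IAnd, IOr, INext, IRelease,
      IFreeze, IUp, INotUp}"
    by (auto intro: isym.exhaust)
  then show "finite (UNIV :: isym set)"
    by (metis finite.emptyI finite.insertI)
qed

instance osym :: finite
proof
  have "(UNIV :: osym set) = {OTick, OSep, OAtom, OFreezeAtom, OTop, OBot, OAnd, OOr}"
    by (auto intro: osym.exhaust)
  then show "finite (UNIV :: osym set)"
    by (metis finite.emptyI finite.insertI)
qed

primrec enc_ltl :: "'a list \<Rightarrow> 'a ltl \<Rightarrow> isym list" where
  "enc_ltl ls (Letter a) = ILetter # replicate (idx ls a) ITick"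
| "enc_ltl ls Top = [ITop]"
| "enc_ltl ls Bot = [IBot]"
| "enc_ltl ls (And \<phi> \<psi>) = IAnd # enc_ltl ls \<phi> @ enc_ltl ls \<psi>"
| "enc_ltl ls (Or \<phi> \<psi>) = IOr # enc_ltl ls \<phi> @ enc_ltl ls \<psi>"
| "enc_ltl ls (Next \<phi>) = INext # enc_ltl ls \<phi>"
| "enc_ltl ls (Release \<phi> \<psi>) = IRelease # enc_ltl ls \<phi> @ enc_ltl ls \<psi>"
| "enc_ltl ls (Freeze \<phi>) = IFreeze # enc_ltl ls \<phi>"
| "enc_ltl ls Up = [IUp]"
| "enc_ltl ls NotUp = [INotUp]"

definition enc_input :: "'a list \<Rightarrow> 'a ltl \<Rightarrow> isym list" where
  "enc_input ls \<phi> = replicate (length ls) ITick @ [ISep] @ enc_ltl ls \<phi>"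

primrec enc_pbf :: "'q list \<Rightarrow> 'q pbf \<Rightarrow> osym list" where
  "enc_pbf qs (Atom q) = OAtom # replicate (idx qs q) OTick"
| "enc_pbf qs (FreezeAtom q) = OFreezeAtom # replicate (idx qs q) OTick"
| "enc_pbf qs PTop = [OTop]"
| "enc_pbf qs PBot = [OBot]"
| "enc_pbf qs (PAnd f g) = OAnd # enc_pbf qs f @ enc_pbf qs g"
| "enc_pbf qs (POr f g) = OOr # enc_pbf qs f @ enc_pbf qs g"

text \<open>The alphabet size, the number of states and the initial state, followed by the table of the
  transition function.\<close>

definition enc_ara :: "'a list \<Rightarrow> 'q list \<Rightarrow> ('q, 'a) ara \<Rightarrow> osym list" where
  "enc_ara ls qs A =
     replicate (length ls) OTick @ [OSep] @
     replicate (length qs) OTick @ [OSep] @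
     replicate (idx qs (start A)) OTick @ [OSep] @
     concat [enc_pbf qs (delta A q a b). q \<leftarrow> qs, a \<leftarrow> ls, b \<leftarrow> [True, False]]"

end

theory Submission
  imports Defs "HOL-Real_Asymp.Real_Asymp"
begin

text \<open>The states of the automaton are the positions of the sentence's prefix encoding. Unfolding a
  subformula up to the next \<^const>\<open>Next\<close> is then a letter-by-letter rewriting of that encoding, so each entry of
  the transition table is written in one left-to-right pass that only needs a few counters bounded by
  the input length. Programs over such counters run in logarithmic space, one binary counter
  per work tape. For the correctness of the automaton, runs consist of obligations that hold at the
  current position, and the release operator is the greatest solution of its unfolding.\<close>

section \<open>Counter programs in logarithmic space\<close>

text \<open>A left-to-right pass over prefix notation can neither reorder nor skip operands, and it
  has no stack. Two counts replace the stack: a subformula is complete once the number of pending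
  subformulae has dropped by one below its value at the start, and the number pending inside the
  outermost \<open>Freeze\<close> tells whether the register is to be read as the current class. The
  obligations to be printed need no search in the input: for a \<open>Next\<close> it is the
  position right behind it, for a \<open>Release\<close> its own position.

  Computability concerns a total function on words, with the space bound on every input. Hence
  \<open>translation\<close> is defined on ill-formed words too, and the program halts on them with
  all counters at most the input length plus one.

  A run may carry more configurations than necessary. Soundness therefore uses only that positive
  formulae are monotone, while completeness takes all obligations that are true.\<close>

datatype 'i test = NZ nat | On "'i icell set"

datatype ('i, 'o) com =
    Skip
  | Inc nat
  | Dec nat
  | Mv dir
  | Out 'o
  | Seq "('i, 'o) com" "('i, 'o) com" (infixr ";;" 60)
  | Cond "'i test" "('i, 'o) com" "('i, 'o) com"
  | While "'i test" "('i, 'o) com"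

type_synonym 'o pstate = "nat \<times> (nat \<Rightarrow> nat) \<times> 'o list"

fun holds :: "'i list \<Rightarrow> 'i test \<Rightarrow> 'o pstate \<Rightarrow> bool" where
  "holds w (NZ j) (p, v, out) \<longleftrightarrow> v j \<noteq> 0"
| "holds w (On S) (p, v, out) \<longleftrightarrow> icell_at w p \<in> S"

text \<open>\<open>Inc\<close> is stuck at \<open>B\<close> and \<open>Dec\<close> at 0, so a
  derivation certifies the result, termination, and that no counter which starts at most
  \<open>B\<close> ever exceeds \<open>B\<close>.\<close>

inductive exec :: "'i list \<Rightarrow> nat \<Rightarrow> ('i, 'o) com \<Rightarrow> 'o pstate \<Rightarrow> 'o pstate \<Rightarrow> bool"
  for w B where
  Skip: "exec w B Skip s s"
| Inc: "v j < B \<Longrightarrow> exec w B (Inc j) (p, v, out) (p, v(j := Suc (v j)), out)"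
| Dec: "v j \<noteq> 0 \<Longrightarrow> exec w B (Dec j) (p, v, out) (p, v(j := v j - 1), out)"
| Mv: "exec w B (Mv d) (p, v, out) (min (move d p) (length w + 1), v, out)"
| Out: "exec w B (Out x) (p, v, out) (p, v, out @ [x])"
| Seq: "exec w B c s t \<Longrightarrow> exec w B c' t u \<Longrightarrow> exec w B (c ;; c') s u"
| CondTrue: "holds w b s \<Longrightarrow> exec w B c s t \<Longrightarrow> exec w B (Cond b c c') s t"
| CondFalse: "\<not> holds w b s \<Longrightarrow> exec w B c' s t \<Longrightarrow> exec w B (Cond b c c') s t"
| WhileTrue: "holds w b s \<Longrightarrow> exec w B c s t \<Longrightarrow> exec w B (While b c) t u \<Longrightarrow>
    exec w B (While b c) s u"
| WhileFalse: "\<not> holds w b s \<Longrightarrow> exec w B (While b c) s s"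

fun counters :: "('i, 'o) com \<Rightarrow> nat set" where
  "counters (Inc j) = {j}"
| "counters (Dec j) = {j}"
| "counters (c ;; c') = counters c \<union> counters c'"
| "counters (Cond b c c') = (case b of NZ j \<Rightarrow> {j} | On _ \<Rightarrow> {}) \<union> counters c \<union> counters c'"
| "counters (While b c) = (case b of NZ j \<Rightarrow> {j} | On _ \<Rightarrow> {}) \<union> counters c"
| "counters _ = {}"

section \<open>Compilation of counter programs into transducers\<close>

datatype phase = Main | Forth | Back bool

type_synonym ('i, 'o) cont = "('i, 'o) com list"

text \<open>An operation \<open>(j, a, a', g)\<close> on tape \<open>j\<close> overwrites the initial run of symbols \<open>a\<close> by
  \<open>a'\<close>, and then replaces the first symbol \<open>x \<noteq> a\<close> by \<open>g x\<close>. The digits 0 and 1 are written as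
  the symbols 1 and 2, least significant digit first, in the cells from 1 on; cell 0
  stays blank, so that the head finds its way back. The symbol \<open>x\<close> is 2 exactly if the zero
  test finds a digit 1.\<close>

fun tape_op :: "('i, 'o) com \<Rightarrow> (nat \<times> nat \<times> nat \<times> (nat \<Rightarrow> nat)) option" where
  "tape_op (Inc j) = Some (j, 2, 1, \<lambda>_. 2)"
| "tape_op (Dec j) = Some (j, 1, 2, \<lambda>_. 1)"
| "tape_op (Cond (NZ j) c c') = Some (j, 1, 1, \<lambda>x. x)"
| "tape_op (While (NZ j) c) = Some (j, 1, 1, \<lambda>x. x)"
| "tape_op _ = None"

fun successors :: "('i, 'o) com \<Rightarrow> bool \<Rightarrow> ('i, 'o) cont" where
  "successors (c ;; c') r = [c, c']"
| "successors (Cond b c c') r = [if r then c else c']"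
| "successors (While b c) r = (if r then [c, While b c] else [])"
| "successors _ r = []"

fun test_on :: "'i icell \<Rightarrow> ('i, 'o) com \<Rightarrow> bool" where
  "test_on x (Cond (On S) c c') \<longleftrightarrow> x \<in> S"
| "test_on x (While (On S) c) \<longleftrightarrow> x \<in> S"
| "test_on x _ \<longleftrightarrow> False"

fun dir_of :: "('i, 'o) com \<Rightarrow> dir" where
  "dir_of (Mv d) = d"
| "dir_of _ = Stay"

fun out_of :: "('i, 'o) com \<Rightarrow> 'o option" where
  "out_of (Out x) = Some x"
| "out_of _ = None"

definition keep :: "nat list \<Rightarrow> (nat \<times> dir) list" where
  "keep ss = map (\<lambda>x. (x, Stay)) ss"

definition touch :: "nat list \<Rightarrow> nat \<Rightarrow> nat \<Rightarrow> dir \<Rightarrow> (nat \<times> dir) list" where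
  "touch ss j x d = (keep ss)[j := (x, d)]"

text \<open>The control state is the list of commands still to be executed. A command without
  counter access takes a single step. A counter access leaves cell 0, sweeps right in phase
  \<open>Forth\<close> and returns in phase \<open>Back r\<close>, which carries the outcome of the
  zero test.\<close>

fun ctrans :: "('i, 'o) cont \<times> phase \<Rightarrow> 'i icell \<Rightarrow> nat list \<Rightarrow>
    ((('i, 'o) cont \<times> phase) \<times> dir \<times> (nat \<times> dir) list \<times> 'o option) option" where
  "ctrans ([], ph) x ss = None"
| "ctrans (c # k, ph) x ss =
     (case tape_op c of
        None \<Rightarrow> Some ((successors c (test_on x c) @ k, Main), dir_of c, keep ss, out_of c)
      | Some (j, a, a', g) \<Rightarrow>
          (case ph of
             Main \<Rightarrow> Some ((c # k, Forth), Stay, touch ss j (ss ! j) GoRight, None)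
           | Forth \<Rightarrow>
               if ss ! j = a then Some ((c # k, Forth), Stay, touch ss j a' GoRight, None)
               else Some ((c # k, Back (ss ! j = 2)), Stay, touch ss j (g (ss ! j)) GoLeft, None)
           | Back r \<Rightarrow>
               if ss ! j = 0 then Some ((successors c r @ k, Main), Stay, keep ss, None)
               else Some ((c # k, Back r), Stay, touch ss j (ss ! j) GoLeft, None)))"

text \<open>An over-approximation of the continuations met while \<open>c\<close> runs in front of
  \<open>k\<close>. It is finite because a loop body always returns to the same
  \<open>While b c # k\<close>.\<close>

fun conts :: "('i, 'o) com \<Rightarrow> ('i, 'o) cont \<Rightarrow> ('i, 'o) cont set" where
  "conts (c ;; c') k = {k, (c ;; c') # k} \<union> conts c (c' # k) \<union> conts c' k"
| "conts (Cond b c c') k = {k, Cond b c c' # k} \<union> conts c k \<union> conts c' k"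
| "conts (While b c) k = {k, While b c # k} \<union> conts c (While b c # k)"
| "conts c k = {k, c # k}"

lemma finite_conts: "finite (conts c k)"
  by (induction c k rule: conts.induct) auto

lemma conts_self: "c # k \<in> conts c k" "k \<in> conts c k"
  by (cases c; simp)+

text \<open>The exception \<open>d # l = k\<close> is the point where \<open>c\<close> has been left
  and the code behind it begins. For the whole program \<open>k\<close> is empty and the exception
  vanishes.\<close>

lemma conts_closed: "d # l \<in> conts c k \<Longrightarrow> d # l = k \<or> successors d r @ l \<in> conts c k"
proof (induction c k rule: conts.induct)
  case (1 c c' k)
  then show ?case
    by (auto simp: conts_self)
next
  case (2 b c c' k)
  then show ?case
    by (cases r) (auto simp: conts_self)
next
  case (3 b c k)
  then show ?case
    by (cases r) (auto simp: conts_self)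
qed auto

text \<open>The simulation enters the tail when the head command has been executed completely, which
  may take many machine steps; closure under single steps does not yield this directly.\<close>

lemma conts_tail: "d # l \<in> conts c k \<Longrightarrow> d # l = k \<or> l \<in> conts c k"
proof (induction c k rule: conts.induct)
  case (1 c c' k)
  then show ?case
    by (auto simp: conts_self)
next
  case (2 b c c' k)
  then show ?case
    by (auto simp: conts_self)
next
  case (3 b c k)
  then show ?case
    by (auto simp: conts_self)
qed (auto simp: conts_self)

definition ctrl :: "('i, 'o) com \<Rightarrow> (('i, 'o) cont \<times> phase) set" where
  "ctrl c = conts c [] \<times> {Main, Forth, Back True, Back False}"

lemma finite_ctrl: "finite (ctrl c)"
  by (simp add: ctrl_def finite_conts)

lemma ctrans_ctrl:
  assumes "ctrans q x ss = Some (q', d, ws, out)" "q \<in> ctrl c"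
  shows "q' \<in> ctrl c"
proof -
  obtain k0 ph where q: "q = (k0, ph)" by force
  obtain e k where k0: "k0 = e # k"
    using assms(1) by (cases k0) (auto simp: q)
  have *: "e # k \<in> conts c []" "\<And>r. successors e r @ k \<in> conts c []"
    using assms(2) conts_closed[of e k c "[]"] by (auto simp: q k0 ctrl_def)
  show ?thesis
    using assms(1) * by (auto simp: q k0 ctrl_def split: option.splits phase.splits if_splits)
qed

text \<open>Transducer states are numbers, and any injection of the finitely many pairs into them
  will do.\<close>

definition state_no :: "('i, 'o) com \<Rightarrow> ('i, 'o) cont \<times> phase \<Rightarrow> nat" where
  "state_no c = (SOME f. inj_on f (ctrl c))"

lemma inj_state_no: "inj_on (state_no c) (ctrl c)"
proof -
  have "\<exists>f :: _ \<Rightarrow> nat. inj_on f (ctrl c)"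
    using finite_imp_inj_to_nat_seg[OF finite_ctrl] by blast
  then show ?thesis
    unfolding state_no_def by (rule someI_ex)
qed

definition compile :: "nat \<Rightarrow> ('i, 'o) com \<Rightarrow> ('i, 'o) transducer" where
  "compile K c = \<lparr>num_tapes = K, control = state_no c ` ctrl c, work_syms = {0, 1, 2},
     start_state = state_no c ([c], Main),
     trans = (\<lambda>q x ss. map_option (\<lambda>(q', r). (state_no c q',
       r)) (ctrans (inv_into (ctrl c) (state_no c) q) x ss))\<rparr>"

lemma start_ctrl: "([c], Main) \<in> ctrl c"
  by (simp add: ctrl_def conts_self)

lemma set_keep: "fst ` set (keep ss) = set ss"
  by (force simp: keep_def)

lemma set_touch: "fst ` set (touch ss j x d) \<subseteq> insert x (set ss)"
  using set_update_subset_insert[of "keep ss" j "(x, d)"] set_keep[of ss]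
  unfolding touch_def by fastforce

lemma length_keep [simp]: "length (keep ss) = length ss"
  and length_touch [simp]: "length (touch ss j x d) = length ss"
  by (auto simp: keep_def touch_def)

lemma fst_touch:
  assumes "set ss \<subseteq> S" "j < length ss \<Longrightarrow> x \<in> S"
  shows "fst ` set (touch ss j x d) \<subseteq> S"
proof (cases "j < length ss")
  case True
  then show ?thesis
    using assms set_touch[of ss j x d] by auto
next
  case False
  then show ?thesis
    using assms(1) by (simp add: touch_def set_keep list_update_beyond)
qed

lemma ctrans_syms:
  assumes eq: "ctrans q x ss = Some (q', d, ws, out)" and S: "S = {0, 1, 2}" and ss: "set ss \<subseteq> S"
  shows "length ws = length ss \<and> fst ` set ws \<subseteq> S"
proof -
  obtain e k ph where q: "q = (e # k, ph)"
    using eq by (cases q; cases "fst q") auto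
  have keep: "fst ` set (keep ss) \<subseteq> S"
    unfolding set_keep by (rule ss)
  show ?thesis
  proof (cases "tape_op e")
    case None
    then have "ws = keep ss"
      using eq by (auto simp: q)
    then show ?thesis
      using keep by simp
  next
    case (Some op)
    obtain j a a' g where op: "op = (j, a, a', g)"
      by (cases op)
    have syms: "a' \<in> S" "\<And>y. y \<in> S \<Longrightarrow> g y \<in> S"
      using Some op unfolding S by (auto elim!: tape_op.elims)
    have nth: "j < length ss \<Longrightarrow> ss ! j \<in> S"
      using ss nth_mem by blast
    have t: "fst ` set (touch ss j (ss ! j) d) \<subseteq> S" "fst ` set (touch ss j a' d) \<subseteq> S"
      "fst ` set (touch ss j (g (ss ! j)) d) \<subseteq> S" for d
      by (rule fst_touch[OF ss]; simp add: nth syms)+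
    have "ws \<in> {keep ss} \<union> (\<Union>d. {touch ss j (ss ! j) d, touch ss j a' d, touch ss j (g (ss ! j)) d})"
      using eq by (cases ph) (auto simp: q Some op split: if_splits)
    then show ?thesis
      using keep t by (elim UnE UN_E insertE emptyE) simp_all
  qed
qed

lemma compile_simps [simp]:
  "num_tapes (compile K c) = K" "control (compile K c) = state_no c ` ctrl c"
  "work_syms (compile K c) = {0, 1, 2}" "start_state (compile K c) = state_no c ([c], Main)"
  by (simp_all add: compile_def)

lemma trans_compile:
  "q \<in> ctrl c \<Longrightarrow> trans (compile K c) (state_no c q) x ss =
     map_option (\<lambda>(q', r). (state_no c q', r)) (ctrans q x ss)"
  by (simp add: compile_def inv_into_f_f[OF inj_state_no])

lemma compile_wf: "transducer_wf (compile K c)"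
proof -
  have *: "q' \<in> state_no c ` ctrl c \<and> length ws = K \<and> fst ` set ws \<subseteq> {0, 1, 2}"
    if q: "q \<in> ctrl c" and ss: "length ss = K" "set ss \<subseteq> {0, 1, 2}"
      and eq: "trans (compile K c) (state_no c q) x ss = Some (q', d, ws, out)" for q x ss q' d ws out
  proof -
    obtain y where y: "ctrans q x ss = Some y" "(\<lambda>(q', r). (state_no c q', r)) y = (q', d, ws, out)"
      using eq unfolding trans_compile[OF q] map_option_eq_Some by blast
    obtain q'' where q'': "ctrans q x ss = Some (q'', d, ws, out)" "q' = state_no c q''"
      using y by (cases y) simp
    show ?thesis
      using imageI[OF ctrans_ctrl[OF q''(1) q], of "state_no c"] ctrans_syms[OF q''(1) refl ss(2)]
      unfolding ss(1) q''(2) by (intro conjI) simp_all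
  qed
  show ?thesis
    unfolding transducer_wf_def compile_simps
    by (intro conjI ballI allI impI; (elim conjE imageE, hypsubst)?)
      (use * in \<open>simp_all add: finite_ctrl start_ctrl\<close>)
qed

section \<open>Runs within a space bound\<close>

definition small :: "nat \<Rightarrow> nat \<Rightarrow> 'o config \<Rightarrow> bool" where
  "small K m x \<longleftrightarrow> (\<forall>j<K. wpos x j < m)"

text \<open>Only the source of each step has to be small, so runs compose without a check of the
  last configuration.\<close>

definition run :: "('i, 'o) transducer \<Rightarrow> 'i list \<Rightarrow> nat \<Rightarrow> 'o config \<Rightarrow> 'o config \<Rightarrow> bool" where
  "run M w m = (\<lambda>x y. small (num_tapes M) m x \<and> step M w x = Some y)\<^sup>*\<^sup>*"

lemma run_trans: "run M w m x y \<Longrightarrow> run M w m y z \<Longrightarrow> run M w m x z"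
  unfolding run_def by (rule rtranclp_trans)

lemma run_step: "small (num_tapes M) m x \<Longrightarrow> step M w x = Some y \<Longrightarrow> run M w m x y"
  unfolding run_def by blast

lemma run_reachable: "run M w m (init_config M) x \<Longrightarrow> reachable M w x"
  unfolding run_def reachable_def by (rule rtranclp_mono[THEN predicate2D, rotated]) auto

text \<open>Since \<open>step\<close> is a function, a halting run passes through every
  configuration reachable from its start. One bounded halting run thus bounds them all, as
  \<open>space_bounded\<close> demands.\<close>

lemma run_halt:
  assumes "run M w m x z" "step M w z = None" "small (num_tapes M) m z"
    and "(\<lambda>x y. step M w x = Some y)\<^sup>*\<^sup>* x y"
  shows "small (num_tapes M) m y"
proof -
  from assms(4) have "run M w m y z"
  proof (induction rule: rtranclp_induct)
    case base
    then show ?case by (rule assms(1))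
  next
    case (step y y')
    then show ?case
      using assms(2) by (auto simp: run_def elim: converse_rtranclpE)
  qed
  then show ?thesis
    using assms(3) by (auto simp: run_def elim: converse_rtranclpE)
qed


section \<open>Single steps and sweeps over a work tape\<close>

lemma keep_simps:
  "(\<lambda>j. if j < K then (f j)(h j := fst (keep (map (\<lambda>j. f j (h j)) [0..<K]) ! j)) else f j) = f"
  "(\<lambda>j. if j < K then move (snd (keep (map (\<lambda>j. f j (h j)) [0..<K]) ! j)) (h j) else h j) = h"
  by (auto simp: keep_def fun_eq_iff)

lemma touch_simps:
  assumes "i < K"
  shows "(\<lambda>j. if j < K then (f j)(h j := fst (touch (map (\<lambda>j. f j (h j)) [0..<K]) i y d ! j)) else
      f j) =
    f(i := (f i)(h i := y))"
  "(\<lambda>j. if j < K then move (snd (touch (map (\<lambda>j. f j (h j)) [0..<K]) i y d ! j)) (h j) else h j) =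
    h(i := move d (h i))"
  using assms by (auto simp: keep_def touch_def fun_eq_iff nth_list_update)

lemma step_compile:
  assumes "cstate x = state_no c q" "q \<in> ctrl c"
    and "ctrans q (icell_at w (ipos x)) (map (\<lambda>j. tape x j (wpos x j)) [0..<K]) = Some (q', d, ws, out)"
  shows "step (compile K c) w x = Some
    \<lparr>cstate = state_no c q', ipos = min (move d (ipos x)) (length w + 1),
     tape = (\<lambda>j. if j < K then (tape x j)(wpos x j := fst (ws ! j)) else tape x j),
     wpos = (\<lambda>j. if j < K then move (snd (ws ! j)) (wpos x j) else wpos x j),
     outp = outp x @ (case out of None \<Rightarrow> [] | Some y \<Rightarrow> [y])\<rparr>"
  using assms by (simp add: step_def trans_compile)

lemma step_keep:
  assumes "cstate x = state_no c q" "q \<in> ctrl c"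
    and "ctrans q (icell_at w (ipos x)) (map (\<lambda>j. tape x j (wpos x j)) [0..<K]) =
      Some (q', d, keep (map (\<lambda>j. tape x j (wpos x j)) [0..<K]), out)"
  shows "step (compile K c) w x = Some (x\<lparr>cstate := state_no c q', ipos :=
      min (move d (ipos x)) (length w + 1),
     outp := outp x @ (case out of None \<Rightarrow> [] | Some y \<Rightarrow> [y])\<rparr>)"
  using step_compile[OF assms] unfolding keep_simps by simp

lemma step_touch:
  assumes "cstate x = state_no c q" "q \<in> ctrl c" "j < K" "ipos x \<le> length w + 1"
    and "ctrans q (icell_at w (ipos x)) (map (\<lambda>j. tape x j (wpos x j)) [0..<K]) =
      Some (q', Stay, touch (map (\<lambda>j. tape x j (wpos x j)) [0..<K]) j y d, None)"
  shows "step (compile K c) w x = Some (x\<lparr>cstate := state_no c q',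
     tape := (tape x)(j := (tape x j)(wpos x j := y)),
     wpos := (wpos x)(j := move d (wpos x j))\<rparr>)"
  using step_compile[OF assms(1,2,5)] assms(4) unfolding touch_simps[OF assms(3)] by simp

definition rewrite :: "nat \<Rightarrow> nat \<Rightarrow> (nat \<Rightarrow> nat) \<Rightarrow> (nat \<Rightarrow> nat) \<Rightarrow> nat \<Rightarrow> nat" where
  "rewrite n a' g T = (\<lambda>i. if i \<in> {1..n} then a' else if i = Suc n then g (T i) else T i)"

text \<open>The way back ends at the first blank; as \<open>a'\<close> is not blank, this is cell 0.
  Cell \<open>Suc n\<close> may be blank, but the head has already left it to the left. It is the
  outermost cell scanned, hence \<open>Suc n < m\<close>.\<close>

lemma run_tape_op:
  assumes op: "tape_op e = Some (j, a, a', g)" and a': "a' \<noteq> 0" and j: "j < K"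
    and ek: "e # k \<in> conts c []"
    and x: "cstate x = state_no c (e # k, Main)" "ipos x \<le> length w + 1" "\<And>i. i < K \<Longrightarrow> wpos x i = 0"
    and T: "tape x j 0 = 0" "\<And>i. i \<in> {1..n} \<Longrightarrow> tape x j i = a" "tape x j (Suc n) \<noteq> a" and n: "Suc n < m"
  shows "run (compile K c) w m x (x\<lparr>cstate := state_no c (successors e (tape x j (Suc n) = 2) @ k,
      Main),
    tape := (tape x)(j := rewrite n a' g (tape x j))\<rparr>)"
proof -
  let ?M = "compile K c" and ?T = "tape x j" and ?r = "tape x j (Suc n) = 2"
  have mem: "(e # k, ph) \<in> ctrl c" if "ph \<in> {Main, Forth, Back True, Back False}" for ph
    using ek that by (simp add: ctrl_def)
  have memB: "(e # k, Back r) \<in> ctrl c" for r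
    by (rule mem) auto
  define fwd where "fwd i = x\<lparr>cstate := state_no c (e # k, Forth), wpos := (wpos x)(j := Suc i),
    tape := (tape x)(j := (\<lambda>l. if l \<in> {1..i} then a' else ?T l))\<rparr>" for i
  define bwd where "bwd i = x\<lparr>cstate := state_no c (e # k, Back ?r), wpos := (wpos x)(j := i),
    tape := (tape x)(j := rewrite n a' g ?T)\<rparr>" for i
  have small: "small (num_tapes ?M) m x" "\<And>i. i \<le> n \<Longrightarrow> small (num_tapes ?M) m (fwd i)"
    "\<And>i. i \<le> n \<Longrightarrow> small (num_tapes ?M) m (bwd i)"
    using n x(3) by (auto simp: small_def fwd_def bwd_def)
  have "step ?M w x = Some (fwd 0)"
    using step_touch[OF x(1) mem j x(2), of "(e # k, Forth)" "?T 0" GoRight] x(3)[OF j] j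
    by (simp add: op fwd_def)
  then have start: "run ?M w m x (fwd 0)"
    by (rule run_step[OF small(1)])
  have fwd: "run ?M w m x (fwd i)" if "i \<le> n" for i
    using that
  proof (induction i)
    case 0
    show ?case by (rule start)
  next
    case (Suc i)
    have "(\<lambda>l. if l \<in> {1..i} then a' else ?T l)(Suc i := a') =
      (\<lambda>l. if l \<in> {1..Suc i} then a' else ?T l)"
      by (auto simp: fun_eq_iff)
    then have "step ?M w (fwd i) = Some (fwd (Suc i))"
      using step_touch[of "fwd i" c "(e # k, Forth)" j K w "(e # k, Forth)"
        a' GoRight] mem j x(2) T(2)[of "Suc i"] Suc.prems
      by (simp add: op fwd_def)
    then show ?case
      using Suc run_trans run_step[OF small(2)] by (metis Suc_leD)
  qed
  have "(\<lambda>l. if l \<in> {1..n} then a' else ?T l)(Suc n := g (?T (Suc n))) = rewrite n a' g ?T"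
    by (auto simp: fun_eq_iff rewrite_def)
  then have "step ?M w (fwd n) = Some (bwd n)"
    using step_touch[of "fwd n" c "(e # k, Forth)" j K w "(e # k, Back ?r)" "g (?T (Suc n))"
      GoLeft] mem memB j x(2) T(3)
    by (simp add: op fwd_def bwd_def)
  then have turn: "run ?M w m x (bwd n)"
    using fwd[of n] run_step[OF small(2)] run_trans by blast
  have bwd: "run ?M w m x (bwd (n - i))" if "i \<le> n" for i
    using that
  proof (induction i)
    case 0
    then show ?case using turn by simp
  next
    case (Suc i)
    have "n - i \<in> {1..n}"
      using Suc.prems by auto
    then have "(rewrite n a' g ?T)(n - i := a') = rewrite n a' g ?T" "rewrite n a' g ?T (n - i) = a'"
      by (auto simp: fun_eq_iff rewrite_def)
    then have "step ?M w (bwd (n - i)) = Some (bwd (n - Suc i))"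
      using step_touch[of "bwd (n - i)" c "(e # k, Back ?r)" j K w "(e # k, Back ?r)"
        a' GoLeft] memB j x(2) a'
      by (simp add: op bwd_def)
    then show ?case
      using Suc run_trans run_step[OF small(3)] by (metis Suc_leD diff_le_self)
  qed
  have *: "(wpos x)(j := 0) = wpos x"
    using x(3)[OF j] by (simp add: fun_eq_iff)
  have "rewrite n a' g ?T 0 = 0"
    using T(1) by (simp add: rewrite_def)
  then have "step ?M w (bwd 0) = Some (x\<lparr>cstate := state_no c (successors e ?r @ k, Main),
    tape := (tape x)(j := rewrite n a' g ?T)\<rparr>)"
    using step_keep[of "bwd 0" c "(e # k, Back ?r)" w K "(successors e ?r @ k, Main)"
      Stay None] memB j x(2) x(3)[OF j]
    by (simp add: op bwd_def * config.equality)
  then show ?thesis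
    using bwd[of n] run_step[OF small(3)] run_trans by (metis diff_self_eq_0 le_refl zero_le)
qed


section \<open>Binary counters on tapes\<close>

fun val :: "nat list \<Rightarrow> nat" where
  "val [] = 0"
| "val (x # xs) = x - 1 + 2 * val xs"

definition digits :: "nat list \<Rightarrow> nat \<Rightarrow> nat" where
  "digits xs i = (case i of 0 \<Rightarrow> 0 | Suc i \<Rightarrow> if i < length xs then xs ! i else 0)"

lemma digits_0 [simp]: "digits xs 0 = 0"
  and digits_Suc_0 [simp]: "digits (x # xs) (Suc 0) = x"
  and digits_Suc_Suc [simp]: "digits (x # xs) (Suc (Suc i)) = digits xs (Suc i)"
  and digits_Nil [simp]: "digits [] = (\<lambda>_. 0)"
  by (simp_all add: digits_def fun_eq_iff split: nat.split)

text \<open>Leading zeros are allowed, since a decrement keeps the number of digits. The empty list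
  is a representation of zero, so blank tapes are valid at the start.\<close>

definition digital :: "nat \<Rightarrow> nat \<Rightarrow> (nat \<Rightarrow> nat) \<Rightarrow> bool" where
  "digital L v T \<longleftrightarrow> (\<exists>xs. set xs \<subseteq> {1, 2} \<and> length xs \<le> L \<and> val xs = v \<and> T = digits xs)"

lemma rewrite_digits_Cons:
  assumes "rewrite n a' g (digits xs) = digits ys"
  shows "rewrite (Suc n) a' g (digits (x # xs)) = digits (a' # ys)"
proof
  fix i
  show "rewrite (Suc n) a' g (digits (x # xs)) i = digits (a' # ys) i"
    using fun_cong[OF assms, of "i - 1"]
    by (cases i; cases "i - 1") (auto simp: rewrite_def)
qed

lemma rewrite_digits_0:
  "rewrite 0 a' g (digits (x # xs)) = digits (g x # xs)"
proof
  fix i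
  show "rewrite 0 a' g (digits (x # xs)) i = digits (g x # xs) i"
    by (cases i; cases "i - 1") (auto simp: rewrite_def)
qed

lemma digits_run_Cons:
  assumes "\<And>i. i \<in> {1..n} \<Longrightarrow> digits xs i = a" "i \<in> {1..Suc n}"
  shows "digits (a # xs) i = a"
  using assms(1)[of "i - 1"] assms(2) by (cases i; cases "i - 1") auto

text \<open>The carry turns ones into zeros up to the first zero or blank. The list grows only if
  the carry runs off its end; then all digits are ones and the new value has reached
  \<open>2 ^ length xs\<close>, which keeps the length within \<open>L\<close> for values below
  \<open>2 ^ L\<close>.\<close>

lemma digits_inc:
  assumes "set xs \<subseteq> {1, 2}"
  shows "\<exists>n\<le>length xs. \<exists>ys. (\<forall>i\<in>{1..n}. digits xs i = 2) \<and> digits xs (Suc n) \<noteq> 2 \<and>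
    rewrite n 1 (\<lambda>_. 2) (digits xs) = digits ys \<and> set ys \<subseteq> {1, 2} \<and> val ys = Suc (val xs) \<and>
    (length ys = length xs \<or> length ys = Suc (length xs) \<and> 2 ^ length xs \<le> Suc (val xs))"
  using assms
proof (induction xs)
  case Nil
  have "rewrite 0 1 (\<lambda>_. 2) (\<lambda>_. 0) = digits [2]"
    by (auto simp: fun_eq_iff rewrite_def digits_def split: nat.split)
  then show ?case
    by (intro exI[of _ 0] conjI exI[of _ "[2]"]) auto
next
  case (Cons x xs)
  show ?case
  proof (cases "x = 2")
    case True
    obtain n ys where n: "n \<le> length xs" "\<And>i. i \<in> {1..n} \<Longrightarrow> digits xs i = 2" "digits xs (Suc n) \<noteq> 2"
      and ys: "rewrite n 1 (\<lambda>_. 2) (digits xs) = digits ys" "set ys \<subseteq> {1, 2}" "val ys = Suc (val xs)"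
        "length ys = length xs \<or> length ys = Suc (length xs) \<and> 2 ^ length xs \<le> Suc (val xs)"
      using Cons by auto
    have run: "digits (2 # xs) i = 2" if "i \<in> {1..Suc n}" for i
      using digits_run_Cons[OF n(2) that] .
    show ?thesis
      using n(1,3) run rewrite_digits_Cons[OF ys(1)] ys(2-)
      by (intro exI[of _ "Suc n"] conjI exI[of _ "1 # ys"]) (auto simp: True)
  next
    case False
    then show ?thesis
      using Cons.prems
      by (intro exI[of _ 0] conjI exI[of _ "2 # xs"]) (auto simp: rewrite_digits_0)
  qed
qed

text \<open>A nonzero value has a digit one that stops the borrow before the blanks, so no digit is
  added.\<close>

lemma digits_dec:
  assumes "set xs \<subseteq> {1, 2}" "val xs \<noteq> 0"
  shows "\<exists>n\<le>length xs. \<exists>ys. (\<forall>i\<in>{1..n}. digits xs i = 1) \<and> digits xs (Suc n) \<noteq> 1 \<and>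
    rewrite n 2 (\<lambda>_. 1) (digits xs) = digits ys \<and> set ys \<subseteq> {1, 2} \<and> val ys = val xs - 1 \<and>
    length ys = length xs"
  using assms
proof (induction xs)
  case (Cons x xs)
  show ?case
  proof (cases "x = 1")
    case True
    obtain n ys where n: "n \<le> length xs" "\<And>i. i \<in> {1..n} \<Longrightarrow> digits xs i = 1" "digits xs (Suc n) \<noteq> 1"
      and ys: "rewrite n 2 (\<lambda>_. 1) (digits xs) = digits ys" "set ys \<subseteq> {1, 2}" "val ys = val xs - 1"
        "length ys = length xs"
      using Cons True by auto
    have run: "digits (1 # xs) i = 1" if "i \<in> {1..Suc n}" for i
      using digits_run_Cons[OF n(2) that] .
    show ?thesis
      using n(1,3) run rewrite_digits_Cons[OF ys(1)] ys(2-) Cons.prems(2)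
      by (intro exI[of _ "Suc n"] conjI exI[of _ "2 # ys"]) (auto simp: True)
  next
    case False
    then show ?thesis
      using Cons.prems
      by (intro exI[of _ 0] conjI exI[of _ "1 # xs"]) (auto simp: rewrite_digits_0)
  qed
qed simp

text \<open>The first symbol behind the low-order zeros is a digit one or a blank, and this decides
  the test.\<close>

lemma digits_zero:
  assumes "set xs \<subseteq> {1, 2}"
  shows "\<exists>n\<le>length xs. (\<forall>i\<in>{1..n}. digits xs i = 1) \<and> digits xs (Suc n) \<noteq> 1 \<and>
    (digits xs (Suc n) = 2 \<longleftrightarrow> val xs \<noteq> 0)"
  using assms
proof (induction xs)
  case (Cons x xs)
  show ?case
  proof (cases "x = 1")
    case True
    obtain n where n: "n \<le> length xs" "\<And>i. i \<in> {1..n} \<Longrightarrow> digits xs i = 1" "digits xs (Suc n) \<noteq> 1"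
      "digits xs (Suc n) = 2 \<longleftrightarrow> val xs \<noteq> 0"
      using Cons by auto
    have run: "digits (1 # xs) i = 1" if "i \<in> {1..Suc n}" for i
      using digits_run_Cons[OF n(2) that] .
    show ?thesis
      using n(1,3,4) run
      by (intro exI[of _ "Suc n"] conjI) (auto simp: True)
  next
    case False
    then show ?thesis
      using Cons.prems by (intro exI[of _ 0]) auto
  qed
qed simp

lemma rewrite_id: "(\<And>i. i \<in> {1..n} \<Longrightarrow> T i = a) \<Longrightarrow> rewrite n a (\<lambda>x. x) T = T"
  by (auto simp: rewrite_def fun_eq_iff)

section \<open>Simulation of programs by machine runs\<close>

definition represents ::
    "('i, 'o) com \<Rightarrow> nat \<Rightarrow> 'i list \<Rightarrow> nat \<Rightarrow> ('i, 'o) cont \<Rightarrow> 'o pstate \<Rightarrow> 'o config \<Rightarrow> bool" where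
  "represents c K w L k s x \<longleftrightarrow> (case s of (p, v, out) \<Rightarrow>
     cstate x = state_no c (k, Main) \<and> ipos x = p \<and> p \<le> length w + 1 \<and> outp x = out \<and>
     (\<forall>j<K. wpos x j = 0 \<and> digital L (v j) (tape x j)))"

lemma represents_small: "represents c K w L k s x \<Longrightarrow> 0 < m \<Longrightarrow> small K m x"
  by (auto simp: represents_def small_def split: prod.splits)

lemma run_plain:
  assumes "represents c K w L (e # k) (p, v, out) x" "e # k \<in> conts c []" "tape_op e = None" "0 < m"
  shows "\<exists>y. run (compile K c) w m x y \<and>
    represents c K w L (successors e (test_on (icell_at w p) e) @ k)
      (min (move (dir_of e) p) (length w + 1), v, out @ (case out_of e of None \<Rightarrow> [] | Some z \<Rightarrow> [z])) y"
proof -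
  have "(e # k, Main) \<in> ctrl c"
    using assms(2) by (simp add: ctrl_def)
  then have "step (compile K c) w x = Some (x\<lparr>cstate :=
      state_no c (successors e (test_on (icell_at w p) e) @ k, Main),
      ipos := min (move (dir_of e) (ipos x)) (length w + 1),
      outp := outp x @ (case out_of e of None \<Rightarrow> [] | Some y \<Rightarrow> [y])\<rparr>)"
    using assms(1,3) by (intro step_keep) (auto simp: represents_def)
  moreover have "small (num_tapes (compile K c)) m x"
    using represents_small[OF assms(1,4)] by simp
  ultimately show ?thesis
    using assms(1)
    by (intro exI conjI[OF run_step]) (assumption+, auto simp: represents_def)
qed

text \<open>The head turns on cell \<open>Suc n\<close> with \<open>n \<le> L\<close>, so the cells
  0 to \<open>L + 1\<close> suffice; this is the origin of \<open>L + 2\<close>.\<close>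

lemma run_counter:
  assumes x: "represents c K w L (e # k) (p, v, out) x" and ek: "e # k \<in> conts c []"
    and op: "tape_op e = Some (j, a, a', g)" "a' \<noteq> 0" "j < K"
    and n: "n \<le> L" "\<And>i. i \<in> {1..n} \<Longrightarrow> tape x j i = a" "tape x j (Suc n) \<noteq> a"
    and d: "digital L v' (rewrite n a' g (tape x j))"
  shows "\<exists>y. run (compile K c) w (L + 2) x y \<and>
    represents c K w L (successors e (tape x j (Suc n) = 2) @ k) (p, v(j := v'), out) y"
proof -
  have "tape x j 0 = 0"
    using x op(3) by (auto simp: represents_def digital_def)
  then have "run (compile K c) w (L + 2) x (x\<lparr>cstate :=
      state_no c (successors e (tape x j (Suc n) = 2) @ k, Main),
      tape := (tape x)(j := rewrite n a' g (tape x j))\<rparr>)"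
    using x n by (intro run_tape_op[OF op ek]) (auto simp: represents_def)
  then show ?thesis
    using x d
    by (intro exI[of _ "x\<lparr>cstate := state_no c (successors e (tape x j (Suc n) = 2) @ k, Main),
      tape := (tape x)(j := rewrite n a' g (tape x j))\<rparr>"] conjI) (auto simp: represents_def)
qed

lemma run_Inc:
  assumes x: "represents c K w L (Inc j # k) (p, v, out) x" and ek: "Inc j # k \<in> conts c []"
    and j: "j < K" and v: "Suc (v j) < 2 ^ L"
  shows "\<exists>y. run (compile K c) w (L + 2) x y \<and> represents c K w L k (p, v(j := Suc (v j)), out) y"
proof -
  obtain xs where xs: "set xs \<subseteq> {1, 2}" "length xs \<le> L" "val xs = v j" "tape x j = digits xs"
    using x j by (auto simp: represents_def digital_def)
  obtain n ys where n: "n \<le> length xs" "\<And>i. i \<in> {1..n} \<Longrightarrow> digits xs i = 2" "digits xs (Suc n) \<noteq> 2"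
    and ys: "rewrite n 1 (\<lambda>_. 2) (digits xs) = digits ys" "set ys \<subseteq> {1, 2}" "val ys = Suc (val xs)"
      "length ys = length xs \<or> length ys = Suc (length xs) \<and> 2 ^ length xs \<le> Suc (val xs)"
    using digits_inc[OF xs(1)] by auto
  have "length ys \<le> L"
  proof (cases "length ys = length xs")
    case False
    then have "(2 :: nat) ^ length xs < 2 ^ L"
      using ys(4) v xs(3) by linarith
    then show ?thesis
      using ys(4) False by auto
  qed (use xs in simp)
  then have "digital L (Suc (v j)) (rewrite n 1 (\<lambda>_. 2) (tape x j))"
    using ys xs by (auto simp: digital_def)
  then show ?thesis
    using run_counter[OF x ek, of j 2 1 "\<lambda>_. 2" n] n xs j by simp
qed

lemma run_Dec:
  assumes x: "represents c K w L (Dec j # k) (p, v, out) x" and ek: "Dec j # k \<in> conts c []"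
    and j: "j < K" and v: "v j \<noteq> 0"
  shows "\<exists>y. run (compile K c) w (L + 2) x y \<and> represents c K w L k (p, v(j := v j - 1), out) y"
proof -
  obtain xs where xs: "set xs \<subseteq> {1, 2}" "length xs \<le> L" "val xs = v j" "tape x j = digits xs"
    using x j by (auto simp: represents_def digital_def)
  obtain n ys where n: "n \<le> length xs" "\<And>i. i \<in> {1..n} \<Longrightarrow> digits xs i = 1" "digits xs (Suc n) \<noteq> 1"
    and ys: "rewrite n 2 (\<lambda>_. 1) (digits xs) = digits ys" "set ys \<subseteq> {1, 2}" "val ys = val xs - 1"
      "length ys = length xs"
    using digits_dec[OF xs(1)] v xs(3) by auto
  have "digital L (v j - 1) (rewrite n 2 (\<lambda>_. 1) (tape x j))"
    using ys xs by (auto simp: digital_def)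
  then show ?thesis
    using run_counter[OF x ek, of j 1 2 "\<lambda>_. 1" n] n xs j by simp
qed

lemma run_NZ:
  assumes x: "represents c K w L (e # k) (p, v, out) x" and ek: "e # k \<in> conts c []"
    and op: "tape_op e = Some (j, 1, 1, \<lambda>x. x)" "j < K"
  shows "\<exists>y. run (compile K c) w (L + 2) x y \<and> represents c K w L (successors e (v j \<noteq> 0) @ k) (p,
      v, out) y"
proof -
  obtain xs where xs: "set xs \<subseteq> {1, 2}" "length xs \<le> L" "val xs = v j" "tape x j = digits xs"
    using x op(2) by (auto simp: represents_def digital_def)
  obtain n where n: "n \<le> length xs" "\<And>i. i \<in> {1..n} \<Longrightarrow> digits xs i = 1" "digits xs (Suc n) \<noteq> 1"
      "digits xs (Suc n) = 2 \<longleftrightarrow> val xs \<noteq> 0"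
    using digits_zero[OF xs(1)] by auto
  have "digital L (v j) (rewrite n 1 (\<lambda>x. x) (tape x j))"
    using rewrite_id[OF n(2)] xs by (auto simp: digital_def)
  then show ?thesis
    using run_counter[OF x ek op(1) _ op(2), of n "v j"] n xs by simp
qed

lemma run_test:
  assumes x: "represents c K w L (e # k) s x" and ek: "e # k \<in> conts c []"
    and e: "e = Cond b d d' \<or> e = While b d" "counters e \<subseteq> {..<K}"
  shows "\<exists>y. run (compile K c) w (L + 2) x y \<and> represents c K w L (successors e (holds w b s) @ k) s y"
proof -
  obtain p v out where s: "s = (p, v, out)"
    by (cases s)
  show ?thesis
  proof (cases b)
    case (NZ j)
    then show ?thesis
      using run_NZ[OF x[unfolded s] ek, of j] e by (auto simp: s)
  next
    case (On S)
    have "p \<le> length w + 1"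
      using x by (simp add: s represents_def)
    moreover have "test_on (icell_at w p) e = holds w b s" "tape_op e = None" "dir_of e = Stay"
      "out_of e = None"
      using e(1) On by (auto simp: s)
    ultimately show ?thesis
      using run_plain[OF x[unfolded s] ek, of "L + 2"] by (simp add: s)
  qed
qed

text \<open>Induction on the derivation for all continuations at once: the first part of a sequence
  runs in front of the second, a loop body in front of its own loop. The bound
  \<open>B < 2 ^ L\<close> enters at \<open>Inc\<close>, where a counter may need one more
  digit.\<close>

lemma run_exec:
  assumes "exec w B e s t" "B < 2 ^ L" "counters e \<subseteq> {..<K}" "e # k \<in> conts c []"
    "represents c K w L (e # k) s x"
  shows "\<exists>y. run (compile K c) w (L + 2) x y \<and> represents c K w L k t y"
  using assms
proof (induction arbitrary: k x)
  case (Skip s)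
  then show ?case
    using run_plain[of c K w L Skip k _ _ _ x "L + 2"] by (cases s) (auto simp: represents_def)
next
  case (Inc v j p out)
  then show ?case
    using run_Inc[of c K w L j k p v out x] by auto
next
  case (Dec v j p out)
  then show ?case
    using run_Dec[of c K w L j k p v out x] by auto
next
  case (Mv d p v out)
  then show ?case
    using run_plain[of c K w L "Mv d" k _ _ _ x "L + 2"] by simp
next
  case (Out z p v out)
  then show ?case
    using run_plain[of c K w L "Out z" k _ _ _ x "L + 2"] by (auto simp: represents_def)
next
  case (Seq a s t a' u)
  have mem: "a # a' # k \<in> conts c []"
    using conts_closed[OF Seq.prems(3), of False] by simp
  have mem': "a' # k \<in> conts c []"
    using conts_tail[OF mem] by simp
  obtain y where y: "run (compile K c) w (L + 2) x y" "represents c K w L (a # a' # k) s y"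
  proof -
    obtain p v out where s: "s = (p, v, out)"
      by (cases s)
    have "p \<le> length w + 1"
      using Seq.prems(4) by (simp add: s represents_def)
    then show thesis
      using run_plain[OF Seq.prems(4)[unfolded s] Seq.prems(3), where m =
        "L + 2"] that by (auto simp: s)
  qed
  obtain z where z: "run (compile K c) w (L + 2) y z" "represents c K w L (a' # k) t z"
    using Seq.IH(1)[OF _ _ mem y(2)] Seq.prems by auto
  obtain z' where "run (compile K c) w (L + 2) z z'" "represents c K w L k u z'"
    using Seq.IH(2)[OF _ _ mem' z(2)] Seq.prems by auto
  then show ?case
    using run_trans y(1) z(1) by blast
next
  case (CondTrue b s a t a')
  have mem: "a # k \<in> conts c []"
    using conts_closed[OF CondTrue.prems(3), of True] by simp
  obtain y where y: "run (compile K c) w (L + 2) x y" "represents c K w L (a # k) s y"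
    using run_test[OF CondTrue.prems(4,3), of b a a'] CondTrue.prems(2) CondTrue.hyps by auto
  obtain z where "run (compile K c) w (L + 2) y z" "represents c K w L k t z"
    using CondTrue.IH[OF _ _ mem y(2)] CondTrue.prems by auto
  then show ?case
    using run_trans y(1) by blast
next
  case (CondFalse b s a' t a)
  have mem: "a' # k \<in> conts c []"
    using conts_closed[OF CondFalse.prems(3), of False] by simp
  obtain y where y: "run (compile K c) w (L + 2) x y" "represents c K w L (a' # k) s y"
    using run_test[OF CondFalse.prems(4,3), of b a a'] CondFalse.prems(2) CondFalse.hyps by auto
  obtain z where "run (compile K c) w (L + 2) y z" "represents c K w L k t z"
    using CondFalse.IH[OF _ _ mem y(2)] CondFalse.prems by auto
  then show ?case
    using run_trans y(1) by blast
next
  case (WhileTrue b s a t u)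
  have mem: "a # While b a # k \<in> conts c []"
    using conts_closed[OF WhileTrue.prems(3), of True] by simp
  obtain y where y: "run (compile K c) w (L + 2) x y" "represents c K w L (a # While b a # k) s y"
    using run_test[OF WhileTrue.prems(4,3), of b a a] WhileTrue.prems(2) WhileTrue.hyps by auto
  obtain z where z: "run (compile K c) w (L + 2) y z" "represents c K w L (While b a # k) t z"
    using WhileTrue.IH(1)[OF _ _ mem y(2)] WhileTrue.prems by auto
  obtain z' where "run (compile K c) w (L + 2) z z'" "represents c K w L k u z'"
    using WhileTrue.IH(2)[OF _ _ WhileTrue.prems(3) z(2)] WhileTrue.prems by auto
  then show ?case
    using run_trans y(1) z(1) by blast
next
  case (WhileFalse b s a)
  then show ?case
    using run_test[OF WhileFalse.prems(4,3), of b a a] by auto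
qed

text \<open>The program text bounds the number of work tapes, and the number of binary digits of
  \<open>length w + d\<close> bounds their length. A run is required for every \<open>w\<close>,
  because the space bound concerns all inputs.\<close>

theorem logspace_computable_exec:
  fixes c :: "('i :: finite, 'o :: finite) com" and f :: "'i list \<Rightarrow> 'o list"
  assumes "\<And>w. \<exists>p v. exec w (length w + d) c (0, (\<lambda>_. 0), []) (p, v, f w)"
  shows "logspace_computable f"
proof -
  have "finite (counters c)"
    by (induction c rule: counters.induct) (auto split: test.splits)
  then obtain K where K: "counters c \<subseteq> {..<K}"
    unfolding finite_nat_set_iff_bounded by auto
  \<comment> \<open>The least width with \<open>n + d < 2 ^ L n\<close>.\<close>
  define L where "L n = nat \<lceil>log 2 (real (n + d + 1))\<rceil>" for n
  have L: "n + d < 2 ^ L n" for n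
  proof -
    have "real (n + d + 1) = 2 powr (log 2 (real (n + d + 1)))"
      by simp
    also have "\<dots> \<le> 2 powr (real (L n))"
      unfolding L_def by (intro powr_mono) linarith+
    also have "\<dots> = real (2 ^ L n)"
      by (simp add: powr_realpow)
    finally show ?thesis
      using of_nat_le_iff[where 'a = real, of "n + d + 1" "2 ^ L n"] by linarith
  qed
  let ?M = "compile K c"
  have halts: "\<exists>z. run ?M w (L (length w) + 2) (init_config ?M) z \<and> step ?M w z = None \<and>
      small K (L (length w) + 2) z \<and> outp z = f w" for w
  proof -
    obtain p v where e: "exec w (length w + d) c (0, (\<lambda>_. 0), []) (p, v, f w)"
      using assms by blast
    have "digital (L (length w)) 0 (\<lambda>_. 0)"
      by (auto simp: digital_def intro: exI[of _ "[]"])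
    then have "represents c K w (L (length w)) [c] (0, (\<lambda>_. 0), []) (init_config ?M)"
      by (simp add: represents_def init_config_def)
    then obtain z where z: "run ?M w (L (length w) + 2) (init_config ?M) z"
        "represents c K w (L (length w)) [] (p, v, f w) z"
      using run_exec[OF e L K] conts_self(1) by blast
    have "([], Main) \<in> ctrl c"
      by (simp add: ctrl_def conts_self)
    then have "step ?M w z = None"
      using z(2) by (simp add: step_def represents_def trans_compile)
    then show ?thesis
      using z represents_small[OF z(2), of "L (length w) + 2"] by (auto simp: represents_def)
  qed
  have "space_bounded ?M (\<lambda>n. L n + 2)"
    unfolding space_bounded_def
  proof (intro allI impI)
    fix w x j
    assume "reachable ?M w x" "j < num_tapes ?M"
    then show "wpos x j < L (length w) + 2"
      using run_halt[of ?M w "L (length w) + 2" "init_config ?M" _ x] halts[of w]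
      by (auto simp: reachable_def small_def)
  qed
  moreover have "(\<lambda>n. real (L n + 2)) \<in> O(\<lambda>n. ln (real n))"
  proof -
    \<comment> \<open>Rounding up costs at most 1, and the cells beside the digits cost 2.\<close>
    have "real (L n + 2) \<le> log 2 (real n + (real d + 1)) + 3" for n
    proof -
      have "0 \<le> log 2 (real (n + d + 1))"
        by simp
      then have "real (L n) \<le> log 2 (real (n + d + 1)) + 1"
        unfolding L_def by linarith
      then show ?thesis
        by (simp add: add_ac)
    qed
    then have "(\<lambda>n. real (L n + 2)) \<in> O(\<lambda>n. log 2 (real n + (real d + 1)) + 3)"
      by (intro bigoI[of _ 1] always_eventually allI) (smt (verit) of_nat_0_le_iff real_norm_def)
    also have "(\<lambda>n. log 2 (real n + (real d + 1)) + 3) \<in> O(\<lambda>n. ln (real n))"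
      by real_asymp
    finally show ?thesis .
  qed
  moreover have "outputs ?M w (f w)" for w
    using halts[of w] run_reachable unfolding outputs_def by blast
  ultimately show ?thesis
    unfolding logspace_computable_def using compile_wf by blast
qed

section \<open>The automaton of a sentence\<close>

lemma nth_idx: "x \<in> set xs \<Longrightarrow> xs ! idx xs x = x"
  by (induction xs) (auto simp: idx_def)

lemma idx_less: "x \<in> set xs \<Longrightarrow> idx xs x < length xs"
  by (induction xs) (auto simp: idx_def)

lemma idx_nth: "distinct xs \<Longrightarrow> i < length xs \<Longrightarrow> idx xs (xs ! i) = i"
  using nth_idx[of "xs ! i" xs] idx_less[of "xs ! i" xs] nth_mem[of i xs] nth_eq_iff_index_eq by metis

section \<open>Release as a greatest fixed point\<close>

lemma sat_Release_unfold:
  "sat \<sigma> i D (Release \<phi> \<psi>) \<longleftrightarrow>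
     sat \<sigma> i D \<psi> \<and> (sat \<sigma> i D \<phi> \<or> sat \<sigma> (Suc i) D (Release \<phi> \<psi>))" (is "?l \<longleftrightarrow> ?r")
proof
  assume ?l
  then consider "\<forall>k\<ge>i. sat \<sigma> k D \<psi>"
    | j where "j \<ge> i" "sat \<sigma> j D \<phi>" "\<forall>k\<in>{i..j}. sat \<sigma> k D \<psi>"
    by auto
  then show ?r
  proof cases
    case (2 j)
    then show ?thesis
      by (cases "j = i") (auto intro!: exI[of _ j])
  qed auto
next
  assume r: ?r
  have *: "\<forall>k\<ge>i. sat \<sigma> k D \<psi>" if "\<forall>k\<ge>Suc i. sat \<sigma> k D \<psi>"
    using that r by (metis le_eq_less_or_eq less_eq_Suc_le)
  have **: "\<forall>k\<in>{i..j}. sat \<sigma> k D \<psi>" if "\<forall>k\<in>{Suc i..j}. sat \<sigma> k D \<psi>" for j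
    using that r by (metis atLeastAtMost_iff le_eq_less_or_eq less_eq_Suc_le)
  show ?l
  proof (cases "sat \<sigma> i D \<phi>")
    case True
    then show ?thesis
      using r by (auto intro!: exI[of _ i])
  next
    case False
    then have "(\<forall>k\<ge>Suc i. sat \<sigma> k D \<psi>) \<or> (\<exists>j\<ge>Suc i. sat \<sigma> j D \<phi> \<and> (\<forall>k\<in>{Suc i..j}. sat \<sigma> k D \<psi>))"
      using r by simp
    then show ?thesis
      unfolding sat.simps using * ** Suc_leD by blast
  qed
qed

text \<open>At a position where \<open>R\<close> holds and the release formula fails, \<psi> holds,
  so by the unfolding \<phi> fails and the release formula fails one position later, where
  \<open>R\<close> holds again. Hence \<psi> would hold forever from \<open>i\<close> on, which is
  the first alternative of the semantics.\<close>

lemma sat_Release_coinduct: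
  assumes "R i" and "\<And>k. k \<ge> i \<Longrightarrow> R k \<Longrightarrow> sat \<sigma> k D \<psi> \<and> (sat \<sigma> k D \<phi> \<or> R (Suc k))"
  shows "sat \<sigma> i D (Release \<phi> \<psi>)"
proof (rule ccontr)
  assume neg: "\<not> sat \<sigma> i D (Release \<phi> \<psi>)"
  have "R k \<and> \<not> sat \<sigma> k D (Release \<phi> \<psi>)" if "k \<ge> i" for k
    using that
  proof (induction k rule: dec_induct)
    case base
    then show ?case using neg assms(1) by blast
  next
    case (step k)
    then show ?case
      using assms(2)[of k] sat_Release_unfold[of \<sigma> k D \<phi> \<psi>] by blast
  qed
  then show False
    using assms(2) neg by auto
qed

section \<open>Subformulae addressed by positions in the encoding\<close>

abbreviation enc_size :: "'a list \<Rightarrow> 'a ltl \<Rightarrow> nat" where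
  "enc_size ls \<phi> \<equiv> length (enc_ltl ls \<phi>)"

lemma enc_size_pos: "0 < enc_size ls \<phi>"
  by (cases \<phi>) auto

lemma hd_enc_ltl: "hd (enc_ltl ls \<phi>) \<noteq> ITick"
  by (cases \<phi>) auto

lemma enc_ltl_not_Nil [simp]: "enc_ltl ls \<phi> \<noteq> []"
  by (cases \<phi>) auto

text \<open>Positions inside the unary index of a letter, and those beyond the end, give
  \<open>None\<close>; every other position begins exactly one subformula.\<close>

primrec subformula_at :: "'a list \<Rightarrow> 'a ltl \<Rightarrow> nat \<Rightarrow> 'a ltl option" where
  "subformula_at ls (Letter a) q = (if q = 0 then Some (Letter a) else None)"
| "subformula_at ls Top q = (if q = 0 then Some Top else None)"
| "subformula_at ls Bot q = (if q = 0 then Some Bot else None)"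
| "subformula_at ls (And \<phi> \<psi>) q = (if q = 0 then Some (And \<phi> \<psi>) else
     if q \<le> enc_size ls \<phi> then subformula_at ls \<phi> (q - 1) else subformula_at ls \<psi> (q - 1 -
       enc_size ls \<phi>))"
| "subformula_at ls (Or \<phi> \<psi>) q = (if q = 0 then Some (Or \<phi> \<psi>) else
     if q \<le> enc_size ls \<phi> then subformula_at ls \<phi> (q - 1) else subformula_at ls \<psi> (q - 1 -
       enc_size ls \<phi>))"
| "subformula_at ls (Next \<phi>) q = (if q = 0 then Some (Next \<phi>) else subformula_at ls \<phi> (q - 1))"
| "subformula_at ls (Release \<phi> \<psi>) q = (if q = 0 then Some (Release \<phi> \<psi>) else
     if q \<le> enc_size ls \<phi> then subformula_at ls \<phi> (q - 1) else subformula_at ls \<psi> (q - 1 -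
       enc_size ls \<phi>))"
| "subformula_at ls (Freeze \<phi>) q = (if q = 0 then Some (Freeze \<phi>) else subformula_at ls \<phi> (q - 1))"
| "subformula_at ls Up q = (if q = 0 then Some Up else None)"
| "subformula_at ls NotUp q = (if q = 0 then Some NotUp else None)"

lemma subformula_at_0 [simp]: "subformula_at ls \<phi> 0 = Some \<phi>"
  by (cases \<phi>) auto

lemma subformula_at_bound: "subformula_at ls \<phi> q = Some \<psi> \<Longrightarrow> q + enc_size ls \<psi> \<le> enc_size ls \<phi>"
proof (induction \<phi> arbitrary: q)
  case (And \<phi>1 \<phi>2)
  show ?case
    using And.prems And.IH(1)[of "q - 1"] And.IH(2)[of "q - 1 - enc_size ls \<phi>1"]
    by (cases q) (auto split: if_splits)
next
  case (Or \<phi>1 \<phi>2)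
  show ?case
    using Or.prems Or.IH(1)[of "q - 1"] Or.IH(2)[of "q - 1 - enc_size ls \<phi>1"]
    by (cases q) (auto split: if_splits)
next
  case (Release \<phi>1 \<phi>2)
  show ?case
    using Release.prems Release.IH(1)[of "q - 1"] Release.IH(2)[of "q - 1 - enc_size ls \<phi>1"]
    by (cases q) (auto split: if_splits)
next
  case (Next \<phi>)
  show ?case
    using Next.prems Next.IH[of "q - 1"] by (cases q) auto
next
  case (Freeze \<phi>)
  show ?case
    using Freeze.prems Freeze.IH[of "q - 1"] by (cases q) auto
qed (auto split: if_splits)

lemma subformula_at_less: "subformula_at ls \<phi> q = Some \<psi> \<Longrightarrow> q < enc_size ls \<phi>"
  using subformula_at_bound[of ls \<phi> q \<psi>] enc_size_pos[of ls \<psi>] by linarith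

text \<open>Addresses add up. This locates the operands at the positions that
  \<open>transition\<close> computes from encoded sizes.\<close>

lemma subformula_at_trans:
  "subformula_at ls \<phi> q = Some \<psi> \<Longrightarrow> r < enc_size ls \<psi> \<Longrightarrow> subformula_at ls \<phi> (q + r) =
      subformula_at ls \<psi> r"
proof (induction \<phi> arbitrary: q)
  case (And \<phi>1 \<phi>2)
  show ?case
    using And.prems And.IH(1)[of "q - 1"] And.IH(2)[of "q - 1 - enc_size ls \<phi>1"]
      subformula_at_bound[of ls \<phi>1 "q - 1" \<psi>]
    by (cases q) (auto split: if_splits simp: not_le Suc_le_eq)
next
  case (Or \<phi>1 \<phi>2)
  show ?case
    using Or.prems Or.IH(1)[of "q - 1"] Or.IH(2)[of "q - 1 - enc_size ls \<phi>1"]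
      subformula_at_bound[of ls \<phi>1 "q - 1" \<psi>]
    by (cases q) (auto split: if_splits simp: not_le Suc_le_eq)
next
  case (Release \<phi>1 \<phi>2)
  show ?case
    using Release.prems Release.IH(1)[of "q - 1"] Release.IH(2)[of "q - 1 - enc_size ls \<phi>1"]
      subformula_at_bound[of ls \<phi>1 "q - 1" \<psi>]
    by (cases q) (auto split: if_splits simp: not_le Suc_le_eq)
next
  case (Next \<phi>)
  show ?case
    using Next.prems Next.IH[of "q - 1"] by (cases q) auto
next
  case (Freeze \<phi>)
  show ?case
    using Freeze.prems Freeze.IH[of "q - 1"] by (cases q) auto
qed (auto split: if_splits)

lemma subformula_at_sub:
  "subformula_at ls \<phi> q = Some (And \<alpha> \<beta>) \<Longrightarrow>
    subformula_at ls \<phi> (Suc q) = Some \<alpha> \<and> subformula_at ls \<phi> (Suc (q + enc_size ls \<alpha>)) = Some \<beta>"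
  "subformula_at ls \<phi> q = Some (Or \<alpha> \<beta>) \<Longrightarrow>
    subformula_at ls \<phi> (Suc q) = Some \<alpha> \<and> subformula_at ls \<phi> (Suc (q + enc_size ls \<alpha>)) = Some \<beta>"
  "subformula_at ls \<phi> q = Some (Release \<alpha> \<beta>) \<Longrightarrow>
    subformula_at ls \<phi> (Suc q) = Some \<alpha> \<and> subformula_at ls \<phi> (Suc (q + enc_size ls \<alpha>)) = Some \<beta>"
  "subformula_at ls \<phi> q = Some (Next \<alpha>) \<Longrightarrow> subformula_at ls \<phi> (Suc q) = Some \<alpha>"
  "subformula_at ls \<phi> q = Some (Freeze \<alpha>) \<Longrightarrow> subformula_at ls \<phi> (Suc q) = Some \<alpha>"
  using subformula_at_trans[of ls \<phi> q _ 1] subformula_at_trans[of ls \<phi> q _ "Suc (enc_size ls \<alpha>)"]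
    Suc_leI[OF enc_size_pos, of ls] by auto

text \<open>The unary index of a letter ends only at the next symbol other than a tick, so what
  follows an encoded formula must not begin with one.\<close>

definition no_tick :: "isym list \<Rightarrow> bool" where
  "no_tick us \<longleftrightarrow> us = [] \<or> hd us \<noteq> ITick"

lemma no_tick_enc: "no_tick us \<Longrightarrow> no_tick (us @ enc_ltl ls \<psi> @ vs)"
  using hd_enc_ltl[of ls \<psi>] enc_ltl_not_Nil[of ls \<psi>] by (cases us) (auto simp: no_tick_def)

lemma no_tick_enc2: "no_tick (enc_ltl ls \<psi> @ vs)"
  using no_tick_enc[of "[]" ls \<psi> vs] by (simp add: no_tick_def)

text \<open>This is why a row can be printed by reading on from the position that names the state:
  the text there begins with the subformula, and the rest cannot prolong a trailing index.\<close>

lemma drop_subformula_at: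
  assumes "subformula_at ls \<phi> q = Some \<psi>" "no_tick vs"
  shows "\<exists>us. no_tick us \<and> drop q (enc_ltl ls \<phi> @ vs) = enc_ltl ls \<psi> @ us"
  using assms
proof (induction \<phi> arbitrary: q vs)
  case (And \<phi>1 \<phi>2)
  show ?case
    using And.prems And.IH(1)[of "q - 1" "enc_ltl ls \<phi>2 @ vs"] And.IH(2)[of "q - 1 - enc_size ls \<phi>1" vs]
      no_tick_enc2[of ls \<phi>2 vs]
    by (cases q) (auto split: if_splits)
next
  case (Or \<phi>1 \<phi>2)
  show ?case
    using Or.prems Or.IH(1)[of "q - 1" "enc_ltl ls \<phi>2 @ vs"] Or.IH(2)[of "q - 1 - enc_size ls \<phi>1" vs]
      no_tick_enc2[of ls \<phi>2 vs]
    by (cases q) (auto split: if_splits)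
next
  case (Release \<phi>1 \<phi>2)
  show ?case
    using Release.prems Release.IH(1)[of "q - 1" "enc_ltl ls \<phi>2 @ vs"] Release.IH(2)[of "q - 1 -
      enc_size ls \<phi>1" vs]
      no_tick_enc2[of ls \<phi>2 vs]
    by (cases q) (auto split: if_splits)
next
  case (Next \<phi>)
  show ?case
    using Next.prems Next.IH[of "q - 1" vs] by (cases q) auto
next
  case (Freeze \<phi>)
  show ?case
    using Freeze.prems Freeze.IH[of "q - 1" vs] by (cases q) auto
qed (auto split: if_splits)

lemma subformula_at_None:
  assumes "subformula_at ls \<phi> q = None" "q < enc_size ls \<phi>"
  shows "enc_ltl ls \<phi> ! q = ITick"
  using assms
proof (induction \<phi> arbitrary: q)
  case (And \<phi>1 \<phi>2)
  show ?case
    using And.prems And.IH(1)[of "q - 1"] And.IH(2)[of "q - 1 - enc_size ls \<phi>1"]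
    by (cases q) (auto simp: nth_append split: if_splits)
next
  case (Or \<phi>1 \<phi>2)
  show ?case
    using Or.prems Or.IH(1)[of "q - 1"] Or.IH(2)[of "q - 1 - enc_size ls \<phi>1"]
    by (cases q) (auto simp: nth_append split: if_splits)
next
  case (Release \<phi>1 \<phi>2)
  show ?case
    using Release.prems Release.IH(1)[of "q - 1"] Release.IH(2)[of "q - 1 - enc_size ls \<phi>1"]
    by (cases q) (auto simp: nth_append split: if_splits)
next
  case (Next \<phi>)
  show ?case
    using Next.prems Next.IH[of "q - 1"] by (cases q) auto
next
  case (Freeze \<phi>)
  show ?case
    using Freeze.prems Freeze.IH[of "q - 1"] by (cases q) auto
qed (auto split: if_splits)

section \<open>Transition formulae and the automaton\<close>

definition state_atom :: "bool \<Rightarrow> nat \<Rightarrow> nat pbf" where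
  "state_atom fr p = (if fr then FreezeAtom p else Atom p)"

definition of_bool_pbf :: "bool \<Rightarrow> nat pbf" where
  "of_bool_pbf b = (if b then PTop else PBot)"

text \<open>The transition formulae have unusual shapes so that their prefix notation results from that
  of the subformula by replacing each symbol locally, from left to right: the operand of \<^const>\<open>Next\<close> is kept in a
  tautology, and the recursive call of \<^const>\<open>Release\<close> comes before both operands. Below a
  \<^const>\<open>Freeze\<close>, the flag \<open>fr\<close> redirects the register to the current class.\<close>

primrec transition :: "'a list \<Rightarrow> nat \<Rightarrow> bool \<Rightarrow> bool \<Rightarrow> nat \<Rightarrow> 'a ltl \<Rightarrow> nat pbf" where
  "transition ls a b fr p (Letter x) = of_bool_pbf (idx ls x = a)"
| "transition ls a b fr p Top = PTop"
| "transition ls a b fr p Bot = PBot"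
| "transition ls a b fr p (And \<phi> \<psi>) =
     PAnd (transition ls a b fr (Suc p) \<phi>) (transition ls a b fr (Suc (p + enc_size ls \<phi>)) \<psi>)"
| "transition ls a b fr p (Or \<phi> \<psi>) =
     POr (transition ls a b fr (Suc p) \<phi>) (transition ls a b fr (Suc (p + enc_size ls \<phi>)) \<psi>)"
| "transition ls a b fr p (Next \<phi>) = PAnd (state_atom fr (Suc p)) (POr PTop (transition ls a b fr
    (Suc p) \<phi>))"
| "transition ls a b fr p (Release \<phi> \<psi>) =
     PAnd (POr (state_atom fr p) (transition ls a b fr (Suc p) \<phi>)) (transition ls a b fr (Suc (p +
       enc_size ls \<phi>)) \<psi>)"
| "transition ls a b fr p (Freeze \<phi>) = transition ls a b True (Suc p) \<phi>"
| "transition ls a b fr p Up = of_bool_pbf (fr \<or> b)"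
| "transition ls a b fr p NotUp = of_bool_pbf (\<not> (fr \<or> b))"

lemma atoms_transition: "subformula_at ls \<phi> p = Some \<psi> \<Longrightarrow>
    atoms (transition ls a b fr p \<psi>) \<subseteq> {0..<enc_size ls \<phi>}"
proof (induction \<psi> arbitrary: fr p)
  case (Next \<psi>)
  show ?case
    using Next.IH[OF subformula_at_sub(4)[OF Next.prems]] subformula_at_less[OF
      subformula_at_sub(4)[OF Next.prems]]
    by (auto simp: state_atom_def)
next
  case (Release \<psi>1 \<psi>2)
  then show ?case
    using subformula_at_sub(3)[OF Release.prems] subformula_at_less[OF Release.prems] by (auto
      simp: state_atom_def)
next
  case (And \<psi>1 \<psi>2)
  then show ?case
    using subformula_at_sub(1)[OF And.prems] by auto
next
  case (Or \<psi>1 \<psi>2)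
  then show ?case
    using subformula_at_sub(2)[OF Or.prems] by auto
next
  case (Freeze \<psi>)
  then show ?case
    using subformula_at_sub(5)[OF Freeze.prems] by auto
qed (auto simp: of_bool_pbf_def)

text \<open>Positions of ticks are states as well, though no transition formula mentions them. Their
  value \<open>PTop\<close> agrees with what the scan prints on a tick.\<close>

definition ara_of :: "'a list \<Rightarrow> 'a ltl \<Rightarrow> (nat, 'a) ara" where
  "ara_of ls \<phi> = \<lparr>states = {0..<enc_size ls \<phi>}, start = 0,
     delta = (\<lambda>q x b. case subformula_at ls \<phi> q of None \<Rightarrow> PTop
       | Some \<psi> \<Rightarrow> transition ls (idx ls x) b False q \<psi>)\<rparr>"

lemma safety_ara_of: "safety_ara S (ara_of ls \<phi>)"
  using enc_size_pos[of ls \<phi>]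
  by (auto simp: safety_ara_def ara_of_def split: option.splits dest!: subsetD[OF atoms_transition])

section \<open>Equality of the two languages\<close>

lemma mem_class_iff:
  assumes "equiv UNIV (eqr \<sigma>)" "D \<in> classes \<sigma>"
  shows "i \<in> D \<longleftrightarrow> D = cls \<sigma> i"
  using assms unfolding classes_def cls_def
  by (metis UNIV_I equiv_class_self quotientE equiv_class_eq Image_singleton_iff)

lemma cls_classes: "cls \<sigma> i \<in> classes \<sigma>"
  by (simp add: classes_def cls_def quotientI)

lemma sat_pbf_mono: "sat_pbf P Q f \<Longrightarrow> P \<subseteq> P' \<Longrightarrow> Q \<subseteq> Q' \<Longrightarrow> sat_pbf P' Q' f"
  by (induction f) auto

text \<open>Truth now reduces to truth at the next position by one unfolding of
  \<open>Release\<close>. The sets \<open>P\<close> and \<open>Q\<close> need only contain the true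
  obligations, for register \<open>D\<close> and for the current class.\<close>

lemma sat_imp_sat_pbf:
  assumes \<sigma>: "\<sigma> \<in> data_words (set ls)" and D: "D \<in> classes \<sigma>"
    and P: "\<And>q \<chi>. subformula_at ls \<phi> q = Some \<chi> \<Longrightarrow> sat \<sigma> (Suc i) D \<chi> \<Longrightarrow> q \<in> P"
    and Q: "\<And>q \<chi>. subformula_at ls \<phi> q = Some \<chi> \<Longrightarrow> sat \<sigma> (Suc i) (cls \<sigma> i) \<chi> \<Longrightarrow> q \<in> Q"
    and "subformula_at ls \<phi> p = Some \<psi>" "letters \<psi> \<subseteq> set ls"
    and "sat \<sigma> i (if fr then cls \<sigma> i else D) \<psi>"
  shows "sat_pbf P Q (transition ls (idx ls (letter \<sigma> i)) (D = cls \<sigma> i) fr p \<psi>)"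
  using assms(5-7)
proof (induction \<psi> arbitrary: fr p)
  case (And \<psi>1 \<psi>2)
  then show ?case
    using subformula_at_sub(1)[OF And.prems(1)] by simp
next
  case (Or \<psi>1 \<psi>2)
  then show ?case
    using subformula_at_sub(2)[OF Or.prems(1)] by auto
next
  case (Next \<psi>)
  then show ?case
    using subformula_at_sub(4)[OF Next.prems(1)] P Q by (auto simp: state_atom_def)
next
  case (Release \<psi>1 \<psi>2)
  let ?E = "if fr then cls \<sigma> i else D"
  have "sat \<sigma> i ?E \<psi>2" "sat \<sigma> i ?E \<psi>1 \<or> sat \<sigma> (Suc i) ?E (Release \<psi>1 \<psi>2)"
    using Release.prems(3) sat_Release_unfold by blast+
  then show ?case
    using subformula_at_sub(3)[OF Release.prems(1)] Release.prems(1,2) Release.IH[of _ fr] P Q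
    by (auto simp: state_atom_def simp del: sat.simps split: if_splits)
next
  case (Freeze \<psi>)
  then show ?case
    using subformula_at_sub(5)[OF Freeze.prems(1)] Freeze.IH[of "Suc p" True] by simp
next
  case Up
  then show ?case
    using mem_class_iff[of \<sigma> D i] \<sigma> D by (auto simp: data_words_def of_bool_pbf_def split: if_splits)
next
  case NotUp
  have "equiv UNIV (eqr \<sigma>)"
    using \<sigma> by (simp add: data_words_def)
  then show ?case
    using NotUp mem_class_iff[of \<sigma> D i] mem_class_iff[of \<sigma> "cls \<sigma> i" i] cls_classes D
    by (auto simp: of_bool_pbf_def split: if_splits)
qed (auto simp: of_bool_pbf_def)

text \<open>Structural induction over all positions suffices: the obligation of a
  \<open>Next\<close> is a smaller formula. Only \<open>Release\<close> leads back to itself, and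
  membership of its configuration in \<open>F\<close> is the coinductive predicate there.\<close>

lemma sat_pbf_imp_sat:
  assumes \<sigma>: "\<sigma> \<in> data_words (set ls)"
    and step: "\<And>i q D \<psi>. (q, D) \<in> F i \<Longrightarrow> subformula_at ls \<phi> q = Some \<psi> \<Longrightarrow>
      sat_pbf {q'. (q', D) \<in> F (Suc i)} {q'. (q', cls \<sigma> i) \<in> F (Suc i)}
        (transition ls (idx ls (letter \<sigma> i)) (D = cls \<sigma> i) False q \<psi>)"
    and "subformula_at ls \<phi> p = Some \<psi>" "letters \<psi> \<subseteq> set ls" "D \<in> classes \<sigma>"
    and "sat_pbf {q'. (q', D) \<in> F (Suc i)} {q'. (q', cls \<sigma> i) \<in> F (Suc i)}
        (transition ls (idx ls (letter \<sigma> i)) (D = cls \<sigma> i) fr p \<psi>)"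
  shows "sat \<sigma> i (if fr then cls \<sigma> i else D) \<psi>"
  using assms(3-6)
proof (induction \<psi> arbitrary: fr p i D)
  case (Letter x)
  have "letter \<sigma> i \<in> set ls"
    using \<sigma> by (auto simp: data_words_def)
  then show ?case
    using Letter nth_idx[of "letter \<sigma> i" ls] nth_idx[of x ls] by (auto simp: of_bool_pbf_def
      split: if_splits)
next
  case (And \<psi>1 \<psi>2)
  show ?case
    using subformula_at_sub(1)[OF And.prems(1)] And.prems And.IH(1)[of "Suc p" D i fr]
      And.IH(2)[of "Suc (p + enc_size ls \<psi>1)" D i fr] by simp
next
  case (Or \<psi>1 \<psi>2)
  show ?case
    using subformula_at_sub(2)[OF Or.prems(1)] Or.prems Or.IH(1)[of "Suc p" D i fr]
      Or.IH(2)[of "Suc (p + enc_size ls \<psi>1)" D i fr] by auto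
next
  case (Next \<psi>)
  let ?E = "if fr then cls \<sigma> i else D"
  have "(Suc p, ?E) \<in> F (Suc i)"
    using Next.prems(4) by (auto simp: state_atom_def split: if_splits)
  moreover have "?E \<in> classes \<sigma>"
    using Next.prems(3) cls_classes by auto
  ultimately show ?case
    using step[of "Suc p" ?E "Suc i" \<psi>] subformula_at_sub(4)[OF Next.prems(1)] Next.prems(2)
      Next.IH[of "Suc p" ?E "Suc i" False] by auto
next
  case (Release \<psi>1 \<psi>2)
  note sub = subformula_at_sub(3)[OF Release.prems(1)]
  let ?E = "if fr then cls \<sigma> i else D"
  have E: "?E \<in> classes \<sigma>"
    using Release.prems(3) cls_classes by auto
  have now: "sat \<sigma> i ?E \<psi>2" "sat \<sigma> i ?E \<psi>1 \<or> (p, ?E) \<in> F (Suc i)"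
    using Release.prems(2-4) sub Release.IH(1)[of "Suc p" D i fr]
      Release.IH(2)[of "Suc (p + enc_size ls \<psi>1)" D i fr] by (auto simp: state_atom_def)
  \<comment> \<open>From the next position on, \<open>?E\<close> is the register value stored in the
    configuration, so the formula is read afresh with the flag \<open>False\<close>.\<close>
  have later: "sat \<sigma> k ?E \<psi>2 \<and> (sat \<sigma> k ?E \<psi>1 \<or> (p, ?E) \<in> F (Suc k))" if "(p, ?E) \<in> F k" for k
    using step[OF that Release.prems(1)] Release.prems(2) sub E Release.IH(1)[of "Suc p" ?E k False]
      Release.IH(2)[of "Suc (p + enc_size ls \<psi>1)" ?E k False] by (auto simp: state_atom_def)
  have "sat \<sigma> (Suc i) ?E (Release \<psi>1 \<psi>2)" if "(p, ?E) \<in> F (Suc i)"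
    using that later by (rule sat_Release_coinduct[of "\<lambda>k. (p, ?E) \<in> F k"])
  then show ?case
    unfolding sat_Release_unfold[of _ i] using now by blast
next
  case (Freeze \<psi>)
  then show ?case
    using subformula_at_sub(5)[OF Freeze.prems(1)] Freeze.IH[of "Suc p" D i True] by simp
next
  case Up
  have "equiv UNIV (eqr \<sigma>)"
    using \<sigma> by (simp add: data_words_def)
  then show ?case
    using Up mem_class_iff[of \<sigma> D i] mem_class_iff[of \<sigma> "cls \<sigma> i" i] cls_classes
    by (auto simp: of_bool_pbf_def split: if_splits)
next
  case NotUp
  have "equiv UNIV (eqr \<sigma>)"
    using \<sigma> by (simp add: data_words_def)
  then show ?case
    using NotUp mem_class_iff[of \<sigma> D i]
    by (auto simp: of_bool_pbf_def split: if_splits)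
qed auto

lemma letters_subformula_at: "subformula_at ls \<phi> q = Some \<psi> \<Longrightarrow> letters \<psi> \<subseteq> letters \<phi>"
  by (induction \<phi> arbitrary: q) (fastforce split: if_splits)+

theorem lang_ara_of:
  assumes "letters \<phi> \<subseteq> set ls"
  shows "lang_ltl (set ls) \<phi> = lang_ara (set ls) (ara_of ls \<phi>)"
proof -
  have start: "start (ara_of ls \<phi>) = 0"
    by (simp add: ara_of_def)
  show ?thesis
  proof (intro equalityI subsetI)
  fix \<sigma>
  assume "\<sigma> \<in> lang_ara (set ls) (ara_of ls \<phi>)"
  then obtain F where \<sigma>: "\<sigma> \<in> data_words (set ls)" and F0: "F 0 = {(0, cls \<sigma> 0)}"
    and F: "\<And>i. ara_step (ara_of ls \<phi>) \<sigma> i (F i) (F (Suc i))"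
    unfolding lang_ara_def mem_Collect_eq start by blast
  \<comment> \<open>The witnesses of the run are contained in the next configuration set, so by
    monotonicity all of it may be used instead.\<close>
  have step: "sat_pbf {q'. (q', D) \<in> F (Suc i)} {q'. (q', cls \<sigma> i) \<in> F (Suc i)}
        (transition ls (idx ls (letter \<sigma> i)) (D = cls \<sigma> i) False q \<psi>)"
    if q: "(q, D) \<in> F i" "subformula_at ls \<phi> q = Some \<psi>" for i q D \<psi>
  proof -
    obtain P P' where P: "\<forall>(q, D)\<in>F i. P (q, D) \<subseteq> states (ara_of ls \<phi>) \<and> P' (q,
      D) \<subseteq> states (ara_of ls \<phi>) \<and>
        sat_pbf (P (q, D)) (P' (q, D)) (delta (ara_of ls \<phi>) q (letter \<sigma> i) (D = cls \<sigma> i))"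
      "F (Suc i) = {(q', D) | q' q D. (q, D) \<in> F i \<and> q' \<in> P (q, D)} \<union>
             {(q', cls \<sigma> i) | q' q D. (q, D) \<in> F i \<and> q' \<in> P' (q, D)}"
      using F[of i] unfolding ara_step_def by (elim conjE exE) (rule that)
    have "sat_pbf (P (q, D)) (P' (q, D)) (delta (ara_of ls \<phi>) q (letter \<sigma> i) (D = cls \<sigma> i))"
      using P(1) q(1) by blast
    then have "sat_pbf (P (q, D)) (P' (q, D)) (transition ls (idx ls (letter \<sigma> i)) (D =
      cls \<sigma> i) False q \<psi>)"
      using q(2) by (simp add: ara_of_def)
    moreover have "P (q, D) \<subseteq> {q'. (q', D) \<in> F (Suc i)}" "P' (q, D) \<subseteq> {q'. (q', cls \<sigma> i) \<in> F (Suc i)}"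
      using q(1) unfolding P(2) by blast+
    ultimately show ?thesis
      by (rule sat_pbf_mono)
  qed
  have "sat_pbf {q'. (q', cls \<sigma> 0) \<in> F (Suc 0)} {q'. (q', cls \<sigma> 0) \<in> F (Suc 0)}
      (transition ls (idx ls (letter \<sigma> 0)) (cls \<sigma> 0 = cls \<sigma> 0) False 0 \<phi>)"
    by (rule step) (simp_all add: F0)
  from sat_pbf_imp_sat[where F = F, OF \<sigma> step subformula_at_0 assms cls_classes this]
  have "sat \<sigma> 0 (cls \<sigma> 0) \<phi>"
    by simp
  then show "\<sigma> \<in> lang_ltl (set ls) \<phi>"
    using \<sigma> by (simp add: lang_ltl_def)
next
  fix \<sigma>
  assume "\<sigma> \<in> lang_ltl (set ls) \<phi>"
  then have \<sigma>: "\<sigma> \<in> data_words (set ls)" and sat: "sat \<sigma> 0 (cls \<sigma> 0) \<phi>"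
    by (auto simp: lang_ltl_def)
  \<comment> \<open>The run keeps every true obligation: all positions whose subformula holds at the
    next position under the given register value.\<close>
  define P where "P i D = {q. \<exists>\<psi>. subformula_at ls \<phi> q = Some \<psi> \<and> sat \<sigma> (Suc i) D \<psi>}" for i D
  define G where "G i X = {(q', D) | q' q D. (q, D) \<in> X \<and> q' \<in> P i D} \<union>
      {(q', cls \<sigma> i) | q' q D. (q, D) \<in> X \<and> q' \<in> P i (cls \<sigma> i)}" for i and X :: "(nat \<times> nat set) set"
  define F where "F = rec_nat {(0, cls \<sigma> 0)} G"
  have F: "F 0 = {(0, cls \<sigma> 0)}" "F (Suc i) = G i (F i)" for i
    by (simp_all add: F_def)
  have P: "P i D \<subseteq> {0..<enc_size ls \<phi>}" for i D
    using subformula_at_less by (auto simp: P_def)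
  \<comment> \<open>There may be infinitely many classes; the configuration sets are finite because
    the classes in use stem from positions up to \<open>i\<close>.\<close>
  have inv: "(\<exists>\<psi>. subformula_at ls \<phi> q = Some \<psi> \<and> sat \<sigma> i D \<psi>) \<and> D \<in> cls \<sigma> ` {..i}" if "(q,
      D) \<in> F i" for i q D
    using that
  proof (induction i arbitrary: q D)
    case 0
    then show ?case using sat by (auto simp: F)
  next
    case (Suc i)
    then show ?case
      unfolding F(2) G_def P_def by (auto simp: atMost_Suc)
  qed
  have sub: "F i \<subseteq> {0..<enc_size ls \<phi>} \<times> cls \<sigma> ` {..i}" for i
    using inv subformula_at_less by fastforce
  have fin: "finite (F i)" for i
    by (rule finite_subset[OF sub]) simp
  have cl: "F i \<subseteq> states (ara_of ls \<phi>) \<times> classes \<sigma>" for i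
    using sub[of i] cls_classes by (fastforce simp: ara_of_def)
  have step: "ara_step (ara_of ls \<phi>) \<sigma> i (F i) (F (Suc i))" for i
    unfolding ara_step_def
  proof (intro conjI fin cl, rule exI[of _ "\<lambda>x. P i (snd x)"],
      rule exI[of _ "\<lambda>_. P i (cls \<sigma> i)"], intro conjI ballI)
    show "F (Suc i) = {(q', D) |q' q D. (q, D) \<in> F i \<and> q' \<in> P i (snd (q, D))} \<union>
      {(q', cls \<sigma> i) |q' q D. (q, D) \<in> F i \<and> q' \<in> P i (cls \<sigma> i)}"
      by (simp add: F(2) G_def)
  next
    fix x
    assume x: "x \<in> F i"
    obtain q D where qD: "x = (q, D)"
      by force
    obtain \<psi> where \<psi>: "subformula_at ls \<phi> q = Some \<psi>" "sat \<sigma> i D \<psi>" "D \<in> classes \<sigma>"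
      using inv[of q D i] x cls_classes by (auto simp: qD)
    have "sat_pbf (P i D) (P i (cls \<sigma> i)) (transition ls (idx ls (letter \<sigma> i)) (D = cls \<sigma> i) False q \<psi>)"
      using \<psi> letters_subformula_at[OF \<psi>(1)] assms
      by (intro sat_imp_sat_pbf[OF \<sigma>, of D \<phi>]) (auto simp: P_def)
    then show "case x of (q, D) \<Rightarrow> P i (snd (q, D)) \<subseteq> states (ara_of ls \<phi>) \<and>
        P i (cls \<sigma> i) \<subseteq> states (ara_of ls \<phi>) \<and>
        sat_pbf (P i (snd (q, D))) (P i (cls \<sigma> i)) (delta (ara_of ls \<phi>) q (letter \<sigma> i) (D = cls \<sigma> i))"
      using \<psi> P by (simp add: qD ara_of_def)
  qed
  then show "\<sigma> \<in> lang_ara (set ls) (ara_of ls \<phi>)"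
    unfolding lang_ara_def mem_Collect_eq start using \<sigma> F(1) by blast
  qed
qed

section \<open>The translation as a counter program\<close>

inductive_cases exec_SeqE: "exec w B (c ;; d) s t"
inductive_cases exec_SkipE: "exec w B Skip s t"
inductive_cases exec_IncE: "exec w B (Inc j) s t"
inductive_cases exec_DecE: "exec w B (Dec j) s t"
inductive_cases exec_MvE: "exec w B (Mv d) s t"
inductive_cases exec_OutE: "exec w B (Out x) s t"
inductive_cases exec_CondE: "exec w B (Cond b c d) s t"
inductive_cases exec_WhileE: "exec w B (While b c) s t"

lemma exec_det: "exec w B c s t \<Longrightarrow> exec w B c s u \<Longrightarrow> u = t"
proof (induction arbitrary: u rule: exec.induct)
  case (Skip s)
  then show ?case by (rule exec_SkipE)
next
  case (Inc v j p out)
  from Inc.prems show ?case by (rule exec_IncE) simp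
next
  case (Dec v j p out)
  from Dec.prems show ?case by (rule exec_DecE) simp
next
  case (Mv m p v out)
  from Mv.prems show ?case by (rule exec_MvE) simp
next
  case (Out x p v out)
  from Out.prems show ?case by (rule exec_OutE) simp
next
  case (Seq c s t c' t')
  from Seq.prems obtain r where "exec w B c s r" "exec w B c' r u"
    by (rule exec_SeqE)
  then show ?case using Seq.IH by simp
next
  case (CondTrue b s c t c')
  from CondTrue.prems show ?case
    by (rule exec_CondE) (simp_all add: CondTrue)
next
  case (CondFalse b s c' t c)
  from CondFalse.prems show ?case
    by (rule exec_CondE) (simp_all add: CondFalse)
next
  case (WhileTrue b s c t t')
  from WhileTrue.prems obtain r where "exec w B c s r" "exec w B (While b c) r u"
    by (rule exec_WhileE) (use WhileTrue.hyps in blast)+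
  then show ?case using WhileTrue.IH by simp
next
  case (WhileFalse b s c)
  from WhileFalse.prems show ?case
    by (rule exec_WhileE) (simp_all add: WhileFalse)
qed

text \<open>By determinism, a known run of the first component can be replaced by its result. As a
  rewrite rule this lets the simplifier execute programs, with loops supplied as lemmas.\<close>

lemma exec_Seq_iff: "exec w B c s s' \<Longrightarrow> exec w B (c ;; d) s t \<longleftrightarrow> exec w B d s' t"
  by (metis exec_det exec.Seq exec_SeqE)

lemma exec_simps [simp]:
  "exec w B Skip s t \<longleftrightarrow> t = s"
  "exec w B (Inc j) (p, v, out) t \<longleftrightarrow> v j < B \<and> t = (p, v(j := Suc (v j)), out)"
  "exec w B (Dec j) (p, v, out) t \<longleftrightarrow> v j \<noteq> 0 \<and> t = (p, v(j := v j - 1), out)"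
  "exec w B (Mv m) (p, v, out) t \<longleftrightarrow> t = (min (move m p) (length w + 1), v, out)"
  "exec w B (Out x) (p, v, out) t \<longleftrightarrow> t = (p, v, out @ [x])"
  "exec w B (Cond b c d) s t \<longleftrightarrow> (if holds w b s then exec w B c s t else exec w B d s t)"
  by (auto intro: exec.intros exec.Dec[simplified] exec.Mv[simplified]
      elim: exec_SkipE exec_IncE exec_DecE exec_MvE exec_OutE exec_CondE)

lemma exec_Seq: "exec w B (c ;; d) s u \<longleftrightarrow> (\<exists>t. exec w B c s t \<and> exec w B d t u)"
  by (blast intro: exec.Seq elim: exec_SeqE)

lemma exec_Seq_simps [simp]:
  "exec w B (Skip ;; c) s t \<longleftrightarrow> exec w B c s t"
  "exec w B (Inc j ;; c) (p, v, out) t \<longleftrightarrow> v j < B \<and> exec w B c (p, v(j := Suc (v j)), out) t"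
  "exec w B (Dec j ;; c) (p, v, out) t \<longleftrightarrow> v j \<noteq> 0 \<and> exec w B c (p, v(j := v j - 1), out) t"
  "exec w B (Mv m ;; c) (p, v, out) t \<longleftrightarrow> exec w B c (min (move m p) (length w + 1), v, out) t"
  "exec w B (Out x ;; c) (p, v, out) t \<longleftrightarrow> exec w B c (p, v, out @ [x]) t"
  "exec w B (Cond b c d ;; e) s t \<longleftrightarrow> (if holds w b s then exec w B (c ;; e) s t else exec w B (d ;;
      e) s t)"
  by (auto simp: exec_Seq)

lemma exec_Seq_assoc [simp]: "exec w B ((c ;; d) ;; e) s t \<longleftrightarrow> exec w B (c ;; d ;; e) s t"
  unfolding exec_Seq by blast

lemma exec_While:
  "exec w B (While b c) s t \<longleftrightarrow> (if holds w b s then exec w B (c ;; While b c) s t else t = s)"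
  by (metis exec.WhileTrue exec.WhileFalse exec_WhileE exec_Seq)

section \<open>Loops on counters\<close>

lemma exec_transfer:
  assumes "i \<noteq> j" "v j + v i \<le> B"
  shows "exec w B (While (NZ i) (Dec i ;; Inc j)) (p, v, out) (p, v(j := v j + v i, i := 0), out)"
  using assms(2)
proof (induction "v i" arbitrary: v)
  case 0
  then show ?case
    using assms(1) by (subst exec_While) (auto simp: fun_eq_iff)
next
  case (Suc n)
  let ?v = "v(i := v i - 1, j := Suc (v j))"
  have "exec w B (While (NZ i) (Dec i ;; Inc j)) (p, ?v, out) (p, ?v(j := ?v j + ?v i, i := 0), out)"
    using Suc.hyps(2) Suc.prems assms(1) by (intro Suc.hyps(1)) auto
  moreover have "?v(j := ?v j + ?v i, i := 0) = v(j := v j + v i, i := 0)"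
    using Suc.hyps(2) assms(1) by (auto simp: fun_eq_iff)
  ultimately show ?case
    using Suc.hyps(2) Suc.prems assms(1) by (subst exec_While) simp
qed

lemma exec_transfer_ticks:
  assumes "i \<noteq> j" "v j + v i \<le> B"
  shows "exec w B (While (NZ i) (Dec i ;; Inc j ;; Out x)) (p, v, out)
    (p, v(j := v j + v i, i := 0), out @ replicate (v i) x)"
  using assms(2)
proof (induction "v i" arbitrary: v out)
  case 0
  then show ?case
    using assms(1) by (subst exec_While) (auto simp: fun_eq_iff)
next
  case (Suc n)
  let ?v = "v(i := v i - 1, j := Suc (v j))"
  have "exec w B (While (NZ i) (Dec i ;; Inc j ;; Out x)) (p, ?v, out @ [x])
      (p, ?v(j := ?v j + ?v i, i := 0), (out @ [x]) @ replicate (?v i) x)"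
    using Suc.hyps(2) Suc.prems assms(1) by (intro Suc.hyps(1)) auto
  moreover have "?v(j := ?v j + ?v i, i := 0) = v(j := v j + v i, i := 0)"
    using Suc.hyps(2) assms(1) by (auto simp: fun_eq_iff)
  moreover have "(out @ [x]) @ replicate (?v i) x = out @ replicate (v i) x"
    using Suc.hyps(2) assms(1) by (cases "v i") auto
  ultimately show ?case
    using Suc.hyps(2) Suc.prems assms(1) by (subst exec_While) simp
qed

lemma exec_drain: "exec w B (While (NZ i) (Dec i)) (p, v, out) (p, v(i := 0), out)"
proof (induction "v i" arbitrary: v)
  case 0
  then show ?case
    by (subst exec_While) (auto simp: fun_eq_iff)
next
  case (Suc n)
  have "exec w B (While (NZ i) (Dec i)) (p, v(i := n), out) (p, v(i := 0), out)"
    using Suc.hyps(1)[of "v(i := n)"] by simp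
  then show ?case
    using Suc.hyps(2)[symmetric] by (subst exec_While) simp
qed

lemma exec_rewind:
  assumes "p \<le> length w + 1"
  shows "exec w B (While (NZ i) (Dec i ;; Mv GoLeft)) (p, v, out) (p - v i, v(i := 0), out)"
  using assms
proof (induction "v i" arbitrary: v p)
  case 0
  then show ?case
    by (subst exec_While) (auto simp: fun_eq_iff)
next
  case (Suc n)
  have "exec w B (While (NZ i) (Dec i ;; Mv GoLeft)) (p - 1, v(i := n), out) (p - 1 - n, v(i :=
      0), out)"
    using Suc.hyps(1)[of "v(i := n)" "p - 1"] Suc.prems by simp
  moreover have "min (p - 1) (length w + 1) = p - 1"
    using Suc.prems by simp
  ultimately show ?case
    using Suc.hyps(2)[symmetric] Suc.prems by (subst exec_While) (simp add: diff_diff_left)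
qed

text \<open>A counter can be read only by counting it down, so it is moved to the scratch counter 5
  while printing and then moved back.\<close>

definition ticks :: "nat \<Rightarrow> ('i, osym) com" where
  "ticks j = While (NZ j) (Dec j ;; Inc 5 ;; Out OTick) ;; While (NZ 5) (Dec 5 ;; Inc j)"

lemma exec_ticks:
  assumes "v 5 = 0" "v j \<le> B" "j \<noteq> 5"
  shows "exec w B (ticks j) (p, v, out) (p, v, out @ replicate (v j) OTick)"
proof -
  let ?v = "v(5 := v 5 + v j, j := 0)"
  have "exec w B (While (NZ j) (Dec j ;; Inc 5 ;; Out OTick)) (p, v, out) (p, ?v,
      out @ replicate (v j) OTick)"
    using assms by (intro exec_transfer_ticks) auto
  moreover have "exec w B (While (NZ 5) (Dec 5 ;; Inc j)) (p, ?v, out @ replicate (v j) OTick)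
      (p, ?v(j := ?v j + ?v 5, 5 := 0), out @ replicate (v j) OTick)"
    using assms by (intro exec_transfer) auto
  moreover have "?v(j := ?v j + ?v 5, 5 := 0) = v"
    using assms by (auto simp: fun_eq_iff)
  ultimately show ?thesis
    unfolding ticks_def by (metis exec.Seq)
qed

text \<open>Counters: the subformulae still to be read in all (\<open>P\<close>) and inside the outermost
  \<^const>\<open>Freeze\<close> (\<open>F\<close>), the distance \<open>Y\<close> of the head from the state \<open>Q\<close> whose row is being
  written, the current letter \<open>A\<close>, the number \<open>R\<close> of letters to come, scratch values \<open>T\<close> and
  \<open>G\<close>.\<close>

definition counts :: "nat \<Rightarrow> nat \<Rightarrow> nat \<Rightarrow> nat \<Rightarrow> nat \<Rightarrow> nat \<Rightarrow> nat \<Rightarrow> nat \<Rightarrow> nat \<Rightarrow> nat" where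
  "counts P F Y Q A T R G = (\<lambda>_. 0)(0 := P, 1 := F, 2 := Y, 3 := Q, 4 := A, 5 := T, 6 := R, 7 := G)"

lemma counts_simps [simp]:
  "counts P F Y Q A T R G 0 = P" "counts P F Y Q A T R G (Suc 0) = F" "counts P F Y Q A T R G 2 = Y"
  "counts P F Y Q A T R G 3 = Q" "counts P F Y Q A T R G 4 = A" "counts P F Y Q A T R G 5 = T"
  "counts P F Y Q A T R G 6 = R" "counts P F Y Q A T R G 7 = G"
  "(counts P F Y Q A T R G)(0 := x) = counts x F Y Q A T R G"
  "(counts P F Y Q A T R G)(Suc 0 := x) = counts P x Y Q A T R G"
  "(counts P F Y Q A T R G)(2 := x) = counts P F x Q A T R G"
  "(counts P F Y Q A T R G)(3 := x) = counts P F Y x A T R G"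
  "(counts P F Y Q A T R G)(4 := x) = counts P F Y Q x T R G"
  "(counts P F Y Q A T R G)(5 := x) = counts P F Y Q A x R G"
  "(counts P F Y Q A T R G)(6 := x) = counts P F Y Q A T x G"
  "(counts P F Y Q A T R G)(7 := x) = counts P F Y Q A T R x"
  by (auto simp: counts_def fun_eq_iff)

section \<open>The program\<close>

definition out_ref :: "('i, osym) com" where
  "out_ref = Cond (NZ 1) (Out OFreezeAtom) (Out OAtom)"

text \<open>The head is at position \<open>Q + Y\<close> of the encoding; printing both in unary
  adds them.\<close>

definition out_pos :: "('i, osym) com" where
  "out_pos = ticks 3 ;; ticks 2"

definition out_bool :: "bool \<Rightarrow> ('i, osym) com" where
  "out_bool b = Out (if b then OTop else OBot)"

text \<open>Pending subformulae replace a parse stack: a leaf settles one, a unary connective none,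
  and a binary one adds one. Counter 1 does the same inside the outermost \<open>Freeze\<close>,
  which sets it to 1; it is back at zero once that operand has been read.\<close>

definition branch :: "('i, osym) com" where
  "branch = Inc 0 ;; Cond (NZ 1) (Inc 1) Skip"

definition finish :: "('i, osym) com" where
  "finish = Dec 0 ;; Cond (NZ 1) (Dec 1) Skip"

definition advance :: "('i, osym) com" where
  "advance = Inc 2 ;; Mv GoRight"

text \<open>Each tick is set off against the current letter: matched ones move to counter 5, surplus
  ones to counter 7. The indices agree iff counters 4 and 7 are both zero afterwards, and adding 5
  to 4 restores the letter.\<close>

definition match_letter :: "(isym, osym) com" where
  "match_letter =
     While (On {Sym ITick}) (Cond (NZ 4) (Dec 4 ;; Inc 5) (Inc 7) ;; advance) ;;
     Cond (NZ 4) (Out OBot) (Cond (NZ 7) (Out OBot) (Out OTop)) ;;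
     While (NZ 5) (Dec 5 ;; Inc 4) ;; While (NZ 7) (Dec 7)"

text \<open>A letter moves the head past its index itself, so the final \<open>advance\<close>
  covers the other symbols only. On the right end marker nothing advances, which keeps the distance
  in counter 2 exact for rewinding. The last branch serves \<open>ITop\<close> as well as stray
  ticks and separators.\<close>

definition visit :: "bool \<Rightarrow> (isym, osym) com" where
  "visit b =
     Cond (On {RightEnd}) (Out OTop ;; finish) (
     Cond (On {Sym ILetter}) (advance ;; match_letter ;; finish) (
     Cond (On {Sym IAnd}) (Out OAnd ;; branch) (
     Cond (On {Sym IOr}) (Out OOr ;; branch) (
     Cond (On {Sym INext}) (Out OAnd ;; out_ref ;; out_pos ;; Out OTick ;; Out OOr ;; Out OTop) (
     Cond (On {Sym IRelease}) (Out OAnd ;; Out OOr ;; out_ref ;; out_pos ;; branch) (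
     Cond (On {Sym IFreeze}) (Cond (NZ 1) Skip (Inc 1)) (
     Cond (On {Sym IBot}) (Out OBot ;; finish) (
     Cond (On {Sym IUp}) (Cond (NZ 1) (Out OTop) (out_bool b) ;; finish) (
     Cond (On {Sym INotUp}) (Cond (NZ 1) (Out OBot) (out_bool (\<not> b)) ;; finish)
     (Out OTop ;; finish)))))))) ;; advance))"

definition row :: "bool \<Rightarrow> (isym, osym) com" where
  "row b = Inc 0 ;; While (NZ 0) (visit b) ;; While (NZ 2) (Dec 2 ;; Mv GoLeft)"

definition table :: "(isym, osym) com" where
  "table = While (On (- {RightEnd})) (
     While (NZ 6) (row True ;; row False ;; Dec 6 ;; Inc 4) ;;
     While (NZ 4) (Dec 4 ;; Inc 6) ;; Inc 3 ;; Mv GoRight)"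

text \<open>The initial state is position 0 with an empty unary index, hence two separators in a
  row. While the states are counted, counter 2 records the way back to the first.\<close>

definition translate :: "(isym, osym) com" where
  "translate =
     Mv GoRight ;; While (On {Sym ITick}) (Inc 6 ;; Out OTick ;; Mv GoRight) ;; Out OSep ;;
     Mv GoRight ;; While (On (- {RightEnd})) (Out OTick ;; advance) ;; Out OSep ;; Out OSep ;;
     While (NZ 2) (Dec 2 ;; Mv GoLeft) ;; table"

section \<open>The output as a function of the word\<close>

lemma icell_at_drop:
  assumes "us = drop (p - 1) w" "1 \<le> p" "p \<le> length w + 1"
  shows "icell_at w p = (case us of [] \<Rightarrow> RightEnd | u # _ \<Rightarrow> Sym u)"
  using assms by (cases us) (auto simp: icell_at_def drop_eq_Nil nth_via_drop split: if_splits
      dest: sym)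

lemma drop_ConsD:
  assumes "u # us = drop (p - 1) w" "1 \<le> p"
  shows "us = drop p w" "p \<le> length w" "min (Suc p) (Suc (length w)) = Suc p"
proof -
  have "drop (Suc (p - 1)) w = us"
    using assms(1) by (metis drop_Suc list.sel(3) tl_drop)
  then show "us = drop p w"
    using assms(2) by simp
  have "p - 1 < length w"
    using assms(1) by (metis drop_eq_Nil list.distinct(1) not_le)
  then show "p \<le> length w" "min (Suc p) (Suc (length w)) = Suc p"
    by auto
qed

definition lead :: "isym list \<Rightarrow> nat" where
  "lead us = length (takeWhile (\<lambda>u. u = ITick) us)"

lemma lead_simps [simp]:
  "lead [] = 0" "lead (ITick # us) = Suc (lead us)" "u \<noteq> ITick \<Longrightarrow> lead (u # us) = 0"
  by (simp_all add: lead_def)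

lemma lead_le: "lead us \<le> length us"
  by (simp add: lead_def length_takeWhile_le)

definition ref_sym :: "nat \<Rightarrow> osym" where
  "ref_sym F = (if F = 0 then OAtom else OFreezeAtom)"

definition bool_sym :: "bool \<Rightarrow> osym" where
  "bool_sym b = (if b then OTop else OBot)"

fun emit :: "bool \<Rightarrow> nat \<Rightarrow> nat \<Rightarrow> isym \<Rightarrow> osym list" where
  "emit b F p IAnd = [OAnd]"
| "emit b F p IOr = [OOr]"
| "emit b F p INext = OAnd # ref_sym F # replicate p OTick @ [OTick, OOr, OTop]"
| "emit b F p IRelease = OAnd # OOr # ref_sym F # replicate p OTick"
| "emit b F p IFreeze = []"
| "emit b F p IBot = [OBot]"
| "emit b F p IUp = [bool_sym (0 < F \<or> b)]"
| "emit b F p INotUp = [bool_sym (\<not> (0 < F \<or> b))]"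
| "emit b F p _ = [OTop]"

fun pend :: "isym \<Rightarrow> nat \<Rightarrow> nat" where
  "pend u n = (if u \<in> {IAnd, IOr, IRelease} then Suc n else if u \<in> {INext, IFreeze} then n else n - 1)"

fun pendF :: "isym \<Rightarrow> nat \<Rightarrow> nat" where
  "pendF u F = (if F = 0 then if u = IFreeze then 1 else 0 else pend u F)"

text \<open>Ill-formed words are scanned as well: every tick or separator, and the end of the word, counts
  as an atomic subformula. So the machine halts on every input.\<close>

function scan :: "nat \<Rightarrow> bool \<Rightarrow> nat \<Rightarrow> isym list \<Rightarrow> nat \<Rightarrow> nat \<Rightarrow> osym list" where
  "scan a b p us 0 F = []"
| "scan a b p [] (Suc P) F = OTop # scan a b p [] P (F - 1)"
| "scan a b p (u # us) (Suc P) F =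
     (if u = ILetter
      then bool_sym (lead us = a) # scan a b (Suc p + lead us) (drop (lead us) us) P (F - 1)
      else emit b F p u @ scan a b (Suc p) us (pend u (Suc P)) (pendF u F))"
  by pat_completeness auto
termination
  \<comment> \<open>A connective raises \<open>P\<close>, so the length of the rest comes first; at
    the end of the word only \<open>P\<close> drops.\<close>
  by (relation "(\<lambda>(a, b, p, us, P, F). length us) <*mlex*> measure (\<lambda>(a, b, p, us, P, F). P)")
    (auto simp: mlex_prod_def intro: wf_mlex)

section \<open>Correctness of the program\<close>

lemma exec_match_loop:
  assumes "us = drop (p - 1) w" "1 \<le> p" "p \<le> length w + 1"
    and "Y + length us \<le> B" "T + A \<le> B" "G + length us \<le> B"
  shows "exec w B (While (On {Sym ITick}) (Cond (NZ 4) (Dec 4 ;; Inc 5) (Inc 7) ;; advance))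
    (p, counts P F Y Q A T R G, out)
    (p + lead us, counts P F (Y + lead us) Q (A - lead us) (T + min A (lead us)) R (G + (lead us -
      A)), out)"
  using assms
proof (induction us arbitrary: p Y A T G)
  case Nil
  then show ?case
    by (subst exec_While) (simp add: icell_at_drop[OF Nil.prems(1-3)])
next
  case (Cons u us)
  note cell = icell_at_drop[OF Cons.prems(1-3)] and D = drop_ConsD[OF Cons.prems(1,2)]
  show ?case
  proof (cases "u = ITick")
    case False
    then show ?thesis
      by (subst exec_While) (simp add: cell)
  next
    case True
    have "us = drop (Suc p - 1) w"
      using D by simp
    then have IH: "exec w B (While (On {Sym ITick}) (Cond (NZ 4) (Dec 4 ;; Inc 5) (Inc 7) ;; advance))
      (Suc p, counts P F (Suc Y) Q A' T' R G', out) (Suc p + lead us,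
        counts P F (Suc Y + lead us) Q (A' - lead us) (T' + min A' (lead us)) R (G' + (lead us -
          A')), out)"
      if "T' + A' \<le> B" "G' + length us \<le> B" for A' T' G'
      using Cons.prems D(2) that by (intro Cons.IH) auto
    show ?thesis
    proof (cases A)
      case 0
      then show ?thesis
        using IH[of T 0 "Suc G"] Cons.prems(4-6) D(3) True
        by (subst exec_While) (simp add: cell advance_def)
    next
      case (Suc A')
      then show ?thesis
        using IH[of "Suc T" A' G] Cons.prems(4-6) D(3) True
        by (subst exec_While) (simp add: cell advance_def)
    qed
  qed
qed

lemma exec_match_letter:
  assumes "us = drop (p - 1) w" "1 \<le> p" "p \<le> length w + 1"
    and "Y + length us \<le> B" "A \<le> B"
  shows "exec w B match_letter (p, counts P F Y Q A 0 R 0, out)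
    (p + lead us, counts P F (Y + lead us) Q A 0 R 0, out @ [bool_sym (lead us = A)])"
proof -
  let ?t = "lead us"
  have 1: "exec w B (While (On {Sym ITick}) (Cond (NZ 4) (Dec 4 ;; Inc 5) (Inc 7) ;; advance))
    (p, counts P F Y Q A 0 R 0, out) (p + ?t, counts P F (Y + ?t) Q (A - ?t) (min A ?t) R (?t -
      A), out)"
    using exec_match_loop[of us p w Y B 0 A 0] assms by simp
  have 2: "exec w B (While (NZ 5) (Dec 5 ;; Inc 4)) (p', counts P F Y Q A' T' R G, out)
    (p', counts P F Y Q (A' + T') 0 R G, out)" if "A' + T' \<le> B" for p' Y G A' T' and out :: "osym list"
    using exec_transfer[of 5 4 "counts P F Y Q A' T' R G" B w p' out] that by simp
  have 3: "exec w B (While (NZ 7) (Dec 7)) (p', counts P F Y Q A' 0 R G, out) t \<longleftrightarrow>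
    t = (p', counts P F Y Q A' 0 R 0, out)" for p' Y G A' t and out :: "osym list"
    using exec_drain[of w B 7 p' "counts P F Y Q A' 0 R G" out] by simp (metis exec_det)
  show ?thesis
    unfolding match_letter_def using assms(5)
    by (auto simp: exec_Seq_iff[OF 1] exec_Seq_iff[OF 2] 3 bool_sym_def min_def)
qed

lemma exec_visit:
  assumes us: "u # us = drop (p - 1) w" "1 \<le> p" "p \<le> length w + 1" and u: "u \<noteq> ILetter"
    and B: "Q + Y \<le> B" "Y < B" "Suc P < B" "F \<le> Suc P"
  shows "exec w B (visit b) (p, counts (Suc P) F Y Q A 0 R 0, out)
    (Suc p, counts (pend u (Suc P)) (pendF u F) (Suc Y) Q A 0 R 0, out @ emit b F (Q + Y) u)"
proof -
  note cell = icell_at_drop[OF us]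
  have pos: "exec w B (ticks 3) (p, counts P' F' Y Q A 0 R 0, o') (p, counts P' F' Y Q A 0 R 0,
      o' @ replicate Q OTick)"
    "exec w B (ticks 2) (p, counts P' F' Y Q A 0 R 0, o') (p, counts P' F' Y Q A 0 R 0,
      o' @ replicate Y OTick)"
    for P' F' o'
    using exec_ticks[of "counts P' F' Y Q A 0 R 0" 3 B w p o']
      exec_ticks[of "counts P' F' Y Q A 0 R 0" 2 B w p o'] B by simp_all
  show ?thesis
    using u B drop_ConsD[OF us(1,2)]
    by (cases u) (auto simp: visit_def cell branch_def finish_def advance_def out_ref_def
      out_pos_def out_bool_def
        exec_Seq_iff[OF pos(1)] exec_Seq_iff[OF pos(2)] ref_sym_def bool_sym_def replicate_add)
qed

lemma exec_visit_end:
  assumes "icell_at w p = RightEnd" "p \<le> length w + 1" "F \<le> Suc P"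
  shows "exec w B (visit b) (p, counts (Suc P) F Y Q A 0 R 0, out)
    (p, counts P (F - 1) Y Q A 0 R 0, out @ [OTop])"
  using assms by (simp add: visit_def finish_def)

lemma exec_visit_letter:
  assumes us: "ILetter # us = drop (p - 1) w" "1 \<le> p" "p \<le> length w + 1"
    and B: "Suc Y + length us \<le> B" "A \<le> B" "F \<le> Suc P"
  shows "exec w B (visit b) (p, counts (Suc P) F Y Q A 0 R 0, out)
    (Suc p + lead us, counts P (F - 1) (Suc Y + lead us) Q A 0 R 0, out @ [bool_sym (lead us = A)])"
proof -
  note cell = icell_at_drop[OF us] and D = drop_ConsD[OF us(1,2)]
  have "exec w B match_letter (Suc p, counts (Suc P) F (Suc Y) Q A 0 R 0, out)
    (Suc p + lead us, counts (Suc P) F (Suc Y + lead us) Q A 0 R 0, out @ [bool_sym (lead us = A)])"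
    using D B by (intro exec_match_letter) auto
  from exec_Seq_iff[OF this] show ?thesis
    using B D(3) by (simp add: visit_def cell advance_def finish_def)
qed

text \<open>\<open>Y\<close> grows as \<open>us\<close> shrinks, and a symbol adds at most one
  pending subformula, so both sums stay within \<open>B\<close>. The invariant
  \<open>F \<le> P\<close> brings counter 1 to zero together with counter 0.\<close>

lemma exec_scan:
  assumes "us = drop (p - 1) w" "1 \<le> p" "p \<le> length w + 1"
    and "Q + Y + length us \<le> B" "P + length us \<le> B" "A \<le> B" "F \<le> P" "x = Q + Y"
  shows "\<exists>d. exec w B (While (NZ 0) (visit b)) (p, counts P F Y Q A 0 R 0, out)
    (p + d, counts 0 0 (Y + d) Q A 0 R 0, out @ scan A b x us P F) \<and> p + d \<le> length w + 1"
  using assms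
proof (induction A b x us P F arbitrary: p Y out rule: scan.induct)
  case (1 a b x us F)
  then show ?case
    by (intro exI[of _ 0]) (simp add: exec_While[of _ _ "NZ 0"])
next
  case (2 a b x P F)
  have F: "F - 1 \<le> P"
    using 2(8) by simp
  have "icell_at w p = RightEnd"
    using icell_at_drop[OF 2(2-4)] by simp
  note visit = exec_Seq_iff[OF exec_visit_end[OF this 2(4,8), of B b Y Q a R out]]
  obtain d where d: "exec w B (While (NZ 0) (visit b)) (p, counts P (F - 1) Y Q a 0 R 0, out @ [OTop])
      (p + d, counts 0 0 (Y + d) Q a 0 R 0, (out @ [OTop]) @ scan a b x [] P (F - 1))"
        "p + d \<le> length w + 1"
    using 2(1)[OF 2(2-5) _ 2(7) F 2(9), of "out @ [OTop]"] 2(6) by auto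
  show ?case
    by (rule exI[of _ d], subst exec_While) (use d visit in simp)
next
  case (3 a b x u us P F)
  note D = drop_ConsD[OF 3(3,4)]
  have B: "Suc Y + length us \<le> B" "Q + Y \<le> B" "Y < B" "Suc P < B"
    using 3(6,7) by simp_all
  show ?case
  proof (cases "u = ILetter")
    case True
    let ?t = "lead us" and ?out = "out @ [bool_sym (lead us = a)]"
    have "exec w B (visit b) (p, counts (Suc P) F Y Q a 0 R 0, out)
      (Suc p + ?t, counts P (F - 1) (Suc Y + ?t) Q a 0 R 0, ?out)"
      using 3(3-5,8,9) B(1) True by (intro exec_visit_letter) auto
    note visit = exec_Seq_iff[OF this]
    have len: "length us + p = length w"
      using D(1,2) by simp
    have c: "Q + (Suc Y + ?t) + length (drop ?t us) \<le> B" "P + length (drop ?t us) \<le> B" "F - 1 \<le> P"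
      "Suc x + ?t = Q + (Suc Y + ?t)" "Suc p + ?t \<le> length w + 1"
      using 3(6,7,9,10) lead_le[of us] len by simp_all
    have tail: "drop ?t us = drop (Suc p + ?t - 1) w"
      by (simp add: D(1) add.commute)
    obtain d where d: "exec w B (While (NZ 0) (visit b)) (Suc p + ?t,
      counts P (F - 1) (Suc Y + ?t) Q a 0 R 0, ?out)
        (Suc p + ?t + d, counts 0 0 (Suc Y + ?t + d) Q a 0 R 0,
         ?out @ scan a b (Suc x + ?t) (drop ?t us) P (F - 1))"
      "Suc p + ?t + d \<le> length w + 1"
      using 3(1)[OF True tail _ _ c(1,2) 3(8) c(3,4), of ?out] c(5) by auto
    show ?thesis
      by (rule exI[of _ "Suc ?t + d"], subst exec_While) (use d visit True in \<open>simp add: add_ac\<close>)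
  next
    case False
    let ?out = "out @ emit b F x u"
    have "exec w B (visit b) (p, counts (Suc P) F Y Q a 0 R 0, out)
      (Suc p, counts (pend u (Suc P)) (pendF u F) (Suc Y) Q a 0 R 0, out @ emit b F (Q + Y) u)"
      using 3(3-5,9) B False by (intro exec_visit) auto
    note visit = exec_Seq_iff[OF this, folded 3(10)]
    have c: "us = drop (Suc p - 1) w" "1 \<le> Suc p" "Suc p \<le> length w + 1" "Q + Suc Y + length us \<le> B"
      "pend u (Suc P) + length us \<le> B" "pendF u F \<le> pend u (Suc P)" "Suc x = Q + Suc Y"
      using 3(6,7,9,10) D(1,2) by auto
    obtain d where d: "exec w B (While (NZ 0) (visit b)) (Suc p,
      counts (pend u (Suc P)) (pendF u F) (Suc Y) Q a 0 R 0, ?out)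
        (Suc p + d, counts 0 0 (Suc Y + d) Q a 0 R 0,
         ?out @ scan a b (Suc x) us (pend u (Suc P)) (pendF u F))"
      "Suc p + d \<le> length w + 1"
      using 3(2)[OF False c(1-5) 3(8) c(6,7), of ?out] by auto
    show ?thesis
      by (rule exI[of _ "Suc d"], subst exec_While) (use d visit False in \<open>simp del: pend.simps
        pendF.simps\<close>)
  qed
qed


lemma exec_row:
  assumes "us = drop (p - 1) w" "1 \<le> p" "p \<le> length w + 1" "Q + length us \<le> B"
      "Suc (length us) \<le> B" "A \<le> B"
  shows "exec w B (row b) (p, counts 0 0 0 Q A 0 R 0, out) (p, counts 0 0 0 Q A 0 R 0,
      out @ scan A b Q us 1 0)"
proof -
  obtain d where d: "exec w B (While (NZ 0) (visit b)) (p, counts 1 0 0 Q A 0 R 0, out)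
      (p + d, counts 0 0 d Q A 0 R 0, out @ scan A b Q us 1 0)" "p + d \<le> length w + 1"
    using exec_scan[of us p w Q 0 B 1 A 0 Q b R out] assms by auto
  have "exec w B (While (NZ 2) (Dec 2 ;; Mv GoLeft)) (p + d, counts 0 0 d Q A 0 R 0,
      out @ scan A b Q us 1 0)
      (p, counts 0 0 0 Q A 0 R 0, out @ scan A b Q us 1 0)"
    using exec_rewind[OF d(2), of B 2 "counts 0 0 d Q A 0 R 0"] by simp
  then show ?thesis
    using d(1) assms(5) by (simp add: row_def exec_Seq_iff)
qed

definition cell :: "nat \<Rightarrow> nat \<Rightarrow> isym list \<Rightarrow> osym list" where
  "cell a q us = scan a True q us 1 0 @ scan a False q us 1 0"

lemma exec_cells:
  assumes us: "us = drop (p - 1) w" "1 \<le> p" "p \<le> length w + 1" "Q + length us \<le> B" "Suc (length us) \<le> B"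
    and "A + R \<le> B"
  shows "exec w B (While (NZ 6) (row True ;; row False ;; Dec 6 ;; Inc 4)) (p,
      counts 0 0 0 Q A 0 R 0, out)
    (p, counts 0 0 0 Q (A + R) 0 0 0, out @ concat (map (\<lambda>a. cell a Q us) [A..<A + R]))"
  using assms(6)
proof (induction R arbitrary: A out)
  case 0
  show ?case
    by (subst exec_While) simp
next
  case (Suc R)
  have A: "A \<le> B"
    using Suc.prems by simp
  have "[A..<A + Suc R] = A # [Suc A..<Suc A + R]"
    by (simp add: upt_conv_Cons)
  then show ?case
    using Suc.IH[of "Suc A" "out @ cell A Q us"] Suc.prems
    by (subst exec_While) (simp add: exec_Seq_iff[OF exec_row[OF us A]] cell_def)
qed

definition cells :: "nat \<Rightarrow> nat \<Rightarrow> isym list \<Rightarrow> osym list" where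
  "cells m q us = concat (map (\<lambda>a. cell a q us) [0..<m])"

lemma exec_table:
  assumes us: "us = drop (h - 1) w" "1 \<le> h" "h \<le> length w + 1"
    and B: "length w + 1 \<le> B" "m \<le> B" and "q \<le> length us"
  shows "exec w B table (h + q, counts 0 0 0 q 0 0 m 0, out)
    (length w + 1, counts 0 0 0 (length us) 0 0 m 0,
     out @ concat (map (\<lambda>q. cells m q (drop q us)) [q..<length us]))"
  using assms(6)
proof (induction "length us - q" arbitrary: q out)
  case 0
  have len: "h + length us = length w + 1"
    using us by simp
  have "q = length us"
    using 0 by simp
  moreover have "icell_at w (length w + 1) = RightEnd"
    by (simp add: icell_at_def)
  ultimately show ?case
    unfolding table_def using len by (subst exec_While) simp
next
  case (Suc n)
  have len: "h + length us = length w + 1"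
    using us by simp
  have q: "q < length us"
    using Suc.hyps(2) by simp
  let ?vs = "drop q us" and ?o = "out @ cells m q (drop q us)"
  have vs: "?vs = drop (h + q - 1) w" "1 \<le> h + q" "h + q \<le> length w + 1"
    "q + length ?vs \<le> B" "Suc (length ?vs) \<le> B"
    using us q B by (auto simp: add.commute)
  have "?vs \<noteq> []"
    using q by simp
  then have cell: "icell_at w (h + q) \<noteq> RightEnd"
    using icell_at_drop[OF vs(1-3)] by (cases ?vs) auto
  have cells: "exec w B (While (NZ 6) (row True ;; row False ;; Dec 6 ;; Inc 4)) (h + q,
      counts 0 0 0 q 0 0 m 0, out)
    (h + q, counts 0 0 0 q m 0 0 0, ?o)"
    using exec_cells[OF vs, of 0 m] B(2) by (simp add: cells_def)
  \<comment> \<open>Counter 4 has taken over the alphabet size from counter 6 and hands it back for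
    the next state.\<close>
  have restore: "exec w B (While (NZ 4) (Dec 4 ;; Inc 6)) (h + q, counts 0 0 0 q m 0 0 0, ?o)
    (h + q, counts 0 0 0 q 0 0 m 0, ?o)"
    using exec_transfer[of 4 6 "counts 0 0 0 q m 0 0 0"] B(2) by simp
  have "[q..<length us] = q # [Suc q..<length us]"
    using q by (simp add: upt_conv_Cons)
  moreover have "exec w B table (h + Suc q, counts 0 0 0 (Suc q) 0 0 m 0, ?o)
    (length w + 1, counts 0 0 0 (length us) 0 0 m 0,
     ?o @ concat (map (\<lambda>q. cells m q (drop q us)) [Suc q..<length us]))"
    using Suc.hyps(2) q by (intro Suc.hyps(1)) auto
  moreover have "min (Suc (h + q)) (Suc (length w)) = Suc (h + q)" "q < B"
    using q len us(2) B(1) by auto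
  ultimately show ?case
    unfolding table_def using cell
    by (subst exec_While) (simp add: exec_Seq_iff[OF cells] exec_Seq_iff[OF restore])
qed

lemma exec_count:
  assumes "us = drop (p - 1) w" "1 \<le> p" "p \<le> length w + 1" "R + length us \<le> B"
  shows "exec w B (While (On {Sym ITick}) (Inc 6 ;; Out OTick ;; Mv GoRight)) (p,
      counts 0 0 0 0 0 0 R 0, out)
    (p + lead us, counts 0 0 0 0 0 0 (R + lead us) 0, out @ replicate (lead us) OTick)"
  using assms
proof (induction us arbitrary: p R out)
  case Nil
  then show ?case
    by (subst exec_While) (simp add: icell_at_drop[OF Nil.prems(1-3)])
next
  case (Cons u us)
  note cell = icell_at_drop[OF Cons.prems(1-3)] and D = drop_ConsD[OF Cons.prems(1,2)]
  show ?case
  proof (cases "u = ITick")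
    case False
    then show ?thesis
      by (subst exec_While) (simp add: cell)
  next
    case True
    then show ?thesis
      using Cons.IH[of "Suc p" "Suc R" "out @ [OTick]"] Cons.prems(4) D
      by (subst exec_While) (simp add: cell)
  qed
qed

lemma exec_measure:
  assumes "us = drop (p - 1) w" "1 \<le> p" "p \<le> length w + 1" "Y + length us \<le> B"
  shows "exec w B (While (On (- {RightEnd})) (Out OTick ;; advance)) (p, counts 0 0 Y 0 0 0 R 0, out)
    (p + length us, counts 0 0 (Y + length us) 0 0 0 R 0, out @ replicate (length us) OTick)"
  using assms
proof (induction us arbitrary: p Y out)
  case Nil
  then show ?case
    by (subst exec_While) (simp add: icell_at_drop[OF Nil.prems(1-3)])
next
  case (Cons u us)
  note cell = icell_at_drop[OF Cons.prems(1-3)] and D = drop_ConsD[OF Cons.prems(1,2)]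
  show ?case
    using Cons.IH[of "Suc p" "Suc Y" "out @ [OTick]"] Cons.prems(4) D
    by (subst exec_While) (simp add: cell advance_def)
qed

definition translation :: "isym list \<Rightarrow> osym list" where
  "translation w =
     (let m = lead w; us = drop (Suc m) w
      in replicate m OTick @ [OSep] @ replicate (length us) OTick @ [OSep, OSep] @
         concat (map (\<lambda>q. cells m q (drop q us)) [0..<length us]))"

lemma exec_translate:
  "\<exists>p v. exec w (length w + 1) translate (0, (\<lambda>_. 0), []) (p, v, translation w)"
proof -
  define m where "m = lead w"
  define us where "us = drop (Suc m) w"
  \<comment> \<open>The head skips the symbol behind the \<open>m\<close> ticks, except on a word of
    ticks only, where it stays on the end marker.\<close>
  define h where "h = min (Suc (Suc m)) (length w + 1)"
  let ?B = "length w + 1" and ?n = "length us"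
  have h: "us = drop (h - 1) w" "1 \<le> h" "h \<le> length w + 1"
    by (auto simp: us_def h_def min_def)
  have h': "Suc (min (Suc m) (length w)) = h"
    by (simp add: h_def)
  have m: "m \<le> length w"
    by (simp add: m_def lead_le)
  have n: "h + ?n = length w + 1"
    using h by simp
  have init: "(\<lambda>_. 0) = counts 0 0 0 0 0 0 0 0"
    by (auto simp: counts_def)
  have 1: "exec w ?B (While (On {Sym ITick}) (Inc 6 ;; Out OTick ;; Mv GoRight)) (1,
      counts 0 0 0 0 0 0 0 0, [])
    (Suc m, counts 0 0 0 0 0 0 m 0, replicate m OTick)"
    using exec_count[of w 1 w 0 ?B "[]"] by (simp add: m_def)
  have 2: "exec w ?B (While (On (- {RightEnd})) (Out OTick ;; advance)) (h, counts 0 0 0 0 0 0 m 0, out)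
    (h + ?n, counts 0 0 ?n 0 0 0 m 0, out @ replicate ?n OTick)" for out
    using exec_measure[OF h, of 0 ?B] n by simp
  have 3: "exec w ?B (While (NZ 2) (Dec 2 ;; Mv GoLeft)) (h + ?n, counts 0 0 ?n 0 0 0 m 0, out)
    (h, counts 0 0 0 0 0 0 m 0, out)" for out :: "osym list"
    using exec_rewind[OF eq_refl[OF n], of ?B 2 "counts 0 0 ?n 0 0 0 m 0" out]
    unfolding counts_simps add_diff_cancel_right' .
  have 4: "exec w ?B table (h, counts 0 0 0 0 0 0 m 0, out) (length w + 1, counts 0 0 0 ?n 0 0 m 0,
     out @ concat (map (\<lambda>q. cells m q (drop q us)) [0..<?n]))" for out
    using exec_table[OF h, of ?B m 0 out] m by simp
  have "exec w ?B translate (0, (\<lambda>_. 0), []) (length w + 1, counts 0 0 0 ?n 0 0 m 0, translation w)"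
    unfolding init translate_def translation_def Let_def m_def[symmetric] us_def[symmetric]
    using 4[of "replicate m OTick @ [OSep] @ replicate ?n OTick @ [OSep, OSep]"]
    by (simp add: exec_Seq_iff[OF 1[simplified]] exec_Seq_iff[OF 2[simplified]] exec_Seq_iff[OF
      3[simplified]] h')
  then show ?thesis
    by blast
qed


section \<open>The printed table is the encoded automaton\<close>

lemma lead_replicate: "no_tick vs \<Longrightarrow> lead (replicate n ITick @ vs) = n"
  by (induction n) (cases vs; simp add: no_tick_def)+

lemma idx_upt: "p < n \<Longrightarrow> idx [0..<n] p = p"
  using idx_nth[of "[0..<n]" p] by simp

lemma enc_state_atom:
  "p < n \<Longrightarrow> enc_pbf [0..<n] (state_atom fr p) = (if fr then OFreezeAtom else OAtom) # replicate p OTick"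
  by (simp add: state_atom_def idx_upt)

lemma enc_of_bool: "enc_pbf qs (of_bool_pbf b) = [bool_sym b]"
  by (simp add: of_bool_pbf_def bool_sym_def)

text \<open>Prefix notation is parsed by counting, whatever text follows. The truncated
  \<open>F - 1\<close> also fits a \<open>Freeze\<close> met with \<open>F = 0\<close>: it sets the
  count to 1, and its operand takes it back to 0.\<close>

lemma scan_enc_ltl:
  assumes "no_tick vs" "p + enc_size ls \<phi> \<le> n"
  shows "scan a b p (enc_ltl ls \<phi> @ vs) (Suc P) F =
    enc_pbf [0..<n] (transition ls a b (0 < F) p \<phi>) @ scan a b (p + enc_size ls \<phi>) vs P (F - 1)"
  using assms
proof (induction \<phi> arbitrary: p vs P F)
  case (Letter x)
  then show ?case
    by (simp add: lead_replicate enc_of_bool)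
next
  case (And \<phi> \<psi>)
  then show ?case
    by (cases "F = 0") (auto simp: no_tick_enc2 add_ac)
next
  case (Or \<phi> \<psi>)
  then show ?case
    by (cases "F = 0") (auto simp: no_tick_enc2 add_ac)
next
  case (Next \<phi>)
  have "Suc p < n"
    using enc_size_pos[of ls \<phi>] Next.prems(2) by (simp del: length_greater_0_conv)
  then show ?case
    using Next by (cases "F = 0") (auto simp: enc_state_atom ref_sym_def replicate_app_Cons_same)
next
  case (Release \<phi> \<psi>)
  then show ?case
    by (cases "F = 0") (auto simp: no_tick_enc2 add_ac enc_state_atom ref_sym_def)
next
  case (Freeze \<phi>)
  then show ?case
    by (cases "F = 0") auto
qed (auto simp: enc_of_bool bool_sym_def)

text \<open>A scan that starts in mid-word with one pending subformula stops exactly at the end of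
  the subformula beginning there, so the text behind it leaves no trace.\<close>

lemma cell_enc_ltl:
  assumes "q < enc_size ls \<phi>" "x \<in> set ls"
  shows "cell (idx ls x) q (drop q (enc_ltl ls \<phi>)) =
    concat (map (\<lambda>b. enc_pbf [0..<enc_size ls \<phi>] (delta (ara_of ls \<phi>) q x b)) [True, False])"
proof -
  have "scan (idx ls x) b q (drop q (enc_ltl ls \<phi>)) 1 0 =
      enc_pbf [0..<enc_size ls \<phi>] (delta (ara_of ls \<phi>) q x b)" for b
  proof (cases "subformula_at ls \<phi> q")
    case None
    then have "drop q (enc_ltl ls \<phi>) = ITick # drop (Suc q) (enc_ltl ls \<phi>)"
      using subformula_at_None[OF None assms(1)] Cons_nth_drop_Suc[OF assms(1)] by simp
    then show ?thesis
      using None by (simp add: ara_of_def)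
  next
    case (Some \<psi>)
    obtain us where us: "no_tick us" "drop q (enc_ltl ls \<phi>) = enc_ltl ls \<psi> @ us"
      using drop_subformula_at[OF Some, of "[]"] by (auto simp: no_tick_def)
    show ?thesis
      using scan_enc_ltl[OF us(1), of q ls \<psi> "enc_size ls \<phi>" "idx ls x"
        b 0 0] subformula_at_bound[OF Some] Some
      by (simp add: us(2) ara_of_def)
  qed
  then show ?thesis
    by (simp add: cell_def)
qed

lemma concat_map_concat: "concat (map (\<lambda>x. concat (f x)) xs) = concat (concat (map f xs))"
  by (induction xs) auto

text \<open>The program runs through letter indices instead of letters; as \<open>ls\<close> is
  distinct, this is the order of the table.\<close>

lemma translation_enc_input:
  assumes "distinct ls"
  shows "translation (enc_input ls \<phi>) = enc_ara ls [0..<enc_size ls \<phi>] (ara_of ls \<phi>)"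
proof -
  let ?n = "enc_size ls \<phi>" and ?A = "ara_of ls \<phi>"
  have lead: "lead (enc_input ls \<phi>) = length ls"
    by (simp add: enc_input_def lead_replicate no_tick_def)
  have drop: "drop (Suc (length ls)) (enc_input ls \<phi>) = enc_ltl ls \<phi>"
    by (simp add: enc_input_def)
  have ls: "ls = map ((!) ls) [0..<length ls]"
    by (simp add: map_nth)
  have "cells (length ls) q (drop q (enc_ltl ls \<phi>)) =
      concat (concat (map (\<lambda>x. map (\<lambda>b. enc_pbf [0..<?n] (delta ?A q x b)) [True, False]) ls))"
    if "q < ?n" for q
  proof -
    have "cells (length ls) q (drop q (enc_ltl ls \<phi>)) =
        concat (map (\<lambda>x. cell (idx ls x) q (drop q (enc_ltl ls \<phi>))) ls)"
      unfolding cells_def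
      by (subst (3) ls) (auto simp: idx_nth[OF assms] intro!: arg_cong[of _ _ concat])
    also have "\<dots> = concat (map (\<lambda>x. concat (map (\<lambda>b. enc_pbf [0..<?n] (delta ?A q x b)) [True,
      False])) ls)"
      using cell_enc_ltl[OF that] by (intro arg_cong[of _ _ concat] map_cong) auto
    finally show ?thesis
      unfolding concat_map_concat .
  qed
  then have "concat (map (\<lambda>q. cells (length ls) q (drop q (enc_ltl ls \<phi>))) [0..<?n]) =
      concat (map (\<lambda>q. concat (concat (map (\<lambda>x. map (\<lambda>b. enc_pbf [0..<?n] (delta ?A q x b)) [True,
        False]) ls))) [0..<?n])"
    by (intro arg_cong[of _ _ concat] map_cong) auto
  moreover have "idx [0..<?n] (start ?A) = 0"
    using idx_upt[OF enc_size_pos] by (simp add: ara_of_def)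
  ultimately show ?thesis
    unfolding translation_def Let_def lead drop enc_ara_def concat_map_concat by simp
qed

theorem theorem2p5:
  shows "\<exists>f :: isym list \<Rightarrow> osym list. logspace_computable f \<and>
    (\<forall>(ls :: 'a list) (\<phi> :: 'a ltl).
       distinct ls \<and> letters \<phi> \<subseteq> set ls \<and> sentence \<phi> \<longrightarrow>
       (\<exists>(A :: (nat, 'a) ara) qs.
          safety_ara (set ls) A \<and> distinct qs \<and> set qs = states A \<and>
          f (enc_input ls \<phi>) = enc_ara ls qs A \<and>
          lang_ltl (set ls) \<phi> = lang_ara (set ls) A))"
proof (intro exI[of _ translation] conjI allI impI)
  show "logspace_computable translation"
    by (rule logspace_computable_exec[OF exec_translate])
  fix ls :: "'a list" and \<phi> :: "'a ltl"
  assume *: "distinct ls \<and> letters \<phi> \<subseteq> set ls \<and> sentence \<phi>"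
  have "set [0..<enc_size ls \<phi>] = states (ara_of ls \<phi>)"
    by (simp add: ara_of_def)
  then show "\<exists>(A :: (nat, 'a) ara) qs. safety_ara (set ls) A \<and> distinct qs \<and> set qs = states A \<and>
      translation (enc_input ls \<phi>) = enc_ara ls qs A \<and> lang_ltl (set ls) \<phi> = lang_ara (set ls) A"
    using * safety_ara_of translation_enc_input lang_ara_of distinct_upt by metis
qed

end
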